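(* There exists a transcendentally transcendental (TT) function that has a Q-FISCIDS representation. That is, there exist an open set $X \subset \mathbb{R}^n$ and an analytic function $\phi$ on $X$ that is not a differentially algebraic (DA) function and that has a Q-FISCIDS representation.
   Context: DA and TT functions. Let $X \subset \mathbb{R}^n$ be open. A (real-)analytic function $\phi : X \to \mathbb{R}$ is called a DA function if for each $i = 1,\ldots,n$ there exist a nonnegative integer $\rho_i$ and a nonzero polynomial $p_i(\xi, Y_0, \ldots, Y_{\rho_i})$ with real coefficients (in the variables $\xi = (\xi_1,\ldots,\xi_n)$ and $Y_0,\ldots,Y_{\rho_i}$) such that $$p_i\left(\xi, \phi(\xi), \frac{\partial \phi(\xi)}{\partial \xi_i}, \ldots, \frac{\partial^{\rho_i}\phi(\xi)}{\partial \xi_i^{\rho_i}}\right) = 0 \quad \text{for all } \xi \in X.$$ An analytic function that is not a DA function is called a TT function. Q-FISCIDS representations. Let $\phi : X \to \mathbb{R}^m$ with $X \subset \mathbb{R}^n$ open. Consider an $N$-dimensional system with fixed initial state $z_0 \in \mathbb{R}^N$ (independent of $\xi$) and constant input $\xi \in X$: $$\dot z(\tau) = F(z(\tau))\,\xi, \quad z(0) = z_0, \qquad y(\tau) = h(z(\tau)),$$ where $F : Z \to \mathbb{R}^{N\times n}$ and $h : Z \to \mathbb{R}^m$ are defined on an open set $Z \subset \mathbb{R}^N$ containing $z_0$. Let $z(\tau;\xi)$ and $y(\tau;\xi)$ denote its state trajectory (in $Z$) and output. If for every $\xi \in X$ the trajectory $z(\tau;\xi)$ is defined for all $\tau \in [0,1]$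 and $y(1;\xi) = \phi(\xi)$, the system is called a FISCIDS (fixed-initial-state constant-input dynamical system) representation of $\phi$. It is a Q-FISCIDS (quadratic) representation if the entries of $F$ are polynomials of degree at most two and the entries of $h$ are affine functions. *)

theory Defs
  imports "HOL-Analysis.Analysis" "HOL-Library.Poly_Mapping"
begin

text \<open>
  The dimensions \<open>n\<close>, \<open>N\<close>, \<open>m\<close> are quantified inside the statement, so a point of
  \<open>n\<close>-dimensional space is a sequence \<open>x :: nat \<Rightarrow> real\<close> with \<open>x i = 0\<close> for \<open>i \<ge> n\<close>, as in
  \<^const>\<open>Euclidean_space\<close>; coordinates are numbered from 0.  Functions on a subset are total
  functions of which only the values on that subset are constrained.
\<close>

type_synonym 'v monom = "'v \<Rightarrow>\<^sub>0 nat"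
type_synonym 'v mpoly = "('v \<Rightarrow>\<^sub>0 nat) \<Rightarrow>\<^sub>0 real"

definition monom_eval :: "'v monom \<Rightarrow> ('v \<Rightarrow> real) \<Rightarrow> real" where
  "monom_eval \<alpha> v = (\<Prod>i\<in>Poly_Mapping.keys \<alpha>. v i ^ Poly_Mapping.lookup \<alpha> i)"

definition monom_degree :: "'v monom \<Rightarrow> nat" where
  "monom_degree \<alpha> = (\<Sum>i\<in>Poly_Mapping.keys \<alpha>. Poly_Mapping.lookup \<alpha> i)"

definition mpoly_eval :: "'v mpoly \<Rightarrow> ('v \<Rightarrow> real) \<Rightarrow> real" where
  "mpoly_eval p v = (\<Sum>\<alpha>\<in>Poly_Mapping.keys p. Poly_Mapping.lookup p \<alpha> * monom_eval \<alpha> v)"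

definition mpoly_vars :: "'v mpoly \<Rightarrow> 'v set" where
  "mpoly_vars p = (\<Union>\<alpha>\<in>Poly_Mapping.keys p. Poly_Mapping.keys \<alpha>)"

definition mpoly_degree_le :: "'v mpoly \<Rightarrow> nat \<Rightarrow> bool" where
  "mpoly_degree_le p d \<longleftrightarrow> (\<forall>\<alpha>\<in>Poly_Mapping.keys p. monom_degree \<alpha> \<le> d)"

text \<open>
  Real-analyticity in \<open>n\<close> variables: near every \<open>a \<in> X\<close> the function is the sum of an
  (unconditionally convergent) power series in \<open>x - a\<close>, indexed by the multi-indices in
  the variables \<open>0, \<dots>, n - 1\<close>.
\<close>

definition real_analytic_on :: "nat \<Rightarrow> ((nat \<Rightarrow> real) \<Rightarrow> real) \<Rightarrow> (nat \<Rightarrow> real) set \<Rightarrow> bool" where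
  "real_analytic_on n \<phi> X \<longleftrightarrow>
     (\<forall>a\<in>X. \<exists>r>0. \<exists>c :: nat monom \<Rightarrow> real. \<forall>x\<in>X. (\<forall>i<n. \<bar>x i - a i\<bar> < r) \<longrightarrow>
        ((\<lambda>\<alpha>. c \<alpha> * monom_eval \<alpha> (\<lambda>i. x i - a i)) has_sum \<phi> x)
          {\<alpha>. Poly_Mapping.keys \<alpha> \<subseteq> {..<n}})"

definition partial_deriv :: "nat \<Rightarrow> ((nat \<Rightarrow> real) \<Rightarrow> real) \<Rightarrow> (nat \<Rightarrow> real) \<Rightarrow> real" where
  "partial_deriv i f x = deriv (\<lambda>t. f (x(i := t))) (x i)"

text \<open>
  In the polynomial \<open>p\<close> below, \<open>Inl j\<close> is the variable \<open>\<xi>\<^sub>j\<close> and \<open>Inr k\<close> is the variable \<open>Y\<^sub>k\<close>,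
  for which the \<open>k\<close>-th partial derivative in direction \<open>i\<close> is substituted.
\<close>

definition DA_on :: "nat \<Rightarrow> ((nat \<Rightarrow> real) \<Rightarrow> real) \<Rightarrow> (nat \<Rightarrow> real) set \<Rightarrow> bool" where
  "DA_on n \<phi> X \<longleftrightarrow> real_analytic_on n \<phi> X \<and>
     (\<forall>i<n. \<exists>\<rho>. \<exists>p :: (nat + nat) mpoly.
        p \<noteq> 0 \<and> mpoly_vars p \<subseteq> Inl ` {..<n} \<union> Inr ` {..\<rho>} \<and>
        (\<forall>\<xi>\<in>X. mpoly_eval p (case_sum \<xi> (\<lambda>k. (partial_deriv i ^^ k) \<phi> \<xi>)) = 0))"

definition TT_on :: "nat \<Rightarrow> ((nat \<Rightarrow> real) \<Rightarrow> real) \<Rightarrow> (nat \<Rightarrow> real) set \<Rightarrow> bool" where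
  "TT_on n \<phi> X \<longleftrightarrow> real_analytic_on n \<phi> X \<and> \<not> DA_on n \<phi> X"

text \<open>
  \<open>F z j i\<close> is the entry of \<open>F(z)\<close> in row \<open>j < N\<close> and column \<open>i < n\<close>.
  At \<open>\<tau> = 0\<close> and \<open>\<tau> = 1\<close> the derivative is one-sided; since \<open>Z\<close> is open, a solution on
  \<open>[0,1]\<close> of a system with locally Lipschitz right-hand side extends beyond both endpoints.
\<close>

definition state_trajectory ::
    "nat \<Rightarrow> nat \<Rightarrow> (nat \<Rightarrow> real) set \<Rightarrow> (nat \<Rightarrow> real) \<Rightarrow> ((nat \<Rightarrow> real) \<Rightarrow> nat \<Rightarrow> nat \<Rightarrow> real) \<Rightarrow>
     (nat \<Rightarrow> real) \<Rightarrow> (real \<Rightarrow> nat \<Rightarrow> real) \<Rightarrow> bool" where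
  "state_trajectory n N Z z0 F \<xi> z \<longleftrightarrow>
     z 0 = z0 \<and> (\<forall>\<tau>\<in>{0..1}. z \<tau> \<in> Z \<and>
       (\<forall>j<N. ((\<lambda>t. z t j) has_real_derivative (\<Sum>i<n. F (z \<tau>) j i * \<xi> i)) (at \<tau> within {0..1})))"

text \<open>
  For locally Lipschitz \<open>F\<close>, in particular for polynomial \<open>F\<close>, the trajectory is unique, so
  that the existential quantifier over \<open>z\<close> refers to the trajectory of the system.
\<close>

definition FISCIDS_rep ::
    "nat \<Rightarrow> nat \<Rightarrow> (nat \<Rightarrow> real) set \<Rightarrow> ((nat \<Rightarrow> real) \<Rightarrow> nat \<Rightarrow> real) \<Rightarrow>
     nat \<Rightarrow> (nat \<Rightarrow> real) set \<Rightarrow> (nat \<Rightarrow> real) \<Rightarrow> ((nat \<Rightarrow> real) \<Rightarrow> nat \<Rightarrow> nat \<Rightarrow> real) \<Rightarrow>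
     ((nat \<Rightarrow> real) \<Rightarrow> nat \<Rightarrow> real) \<Rightarrow> bool" where
  "FISCIDS_rep n m X \<phi> N Z z0 F h \<longleftrightarrow>
     openin (Euclidean_space N) Z \<and> z0 \<in> Z \<and>
     (\<forall>\<xi>\<in>X. \<exists>z. state_trajectory n N Z z0 F \<xi> z \<and> (\<forall>k<m. h (z 1) k = \<phi> \<xi> k))"

definition Q_FISCIDS_rep ::
    "nat \<Rightarrow> nat \<Rightarrow> (nat \<Rightarrow> real) set \<Rightarrow> ((nat \<Rightarrow> real) \<Rightarrow> nat \<Rightarrow> real) \<Rightarrow>
     nat \<Rightarrow> (nat \<Rightarrow> real) set \<Rightarrow> (nat \<Rightarrow> real) \<Rightarrow> ((nat \<Rightarrow> real) \<Rightarrow> nat \<Rightarrow> nat \<Rightarrow> real) \<Rightarrow>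
     ((nat \<Rightarrow> real) \<Rightarrow> nat \<Rightarrow> real) \<Rightarrow> bool" where
  "Q_FISCIDS_rep n m X \<phi> N Z z0 F h \<longleftrightarrow>
     FISCIDS_rep n m X \<phi> N Z z0 F h \<and>
     (\<forall>j<N. \<forall>i<n. \<exists>p :: nat mpoly. mpoly_vars p \<subseteq> {..<N} \<and> mpoly_degree_le p 2 \<and>
        (\<forall>z\<in>Z. F z j i = mpoly_eval p z)) \<and>
     (\<forall>k<m. \<exists>b c. \<forall>z\<in>Z. h z k = b + (\<Sum>j<N. c j * z j))"

definition has_Q_FISCIDS_rep ::
    "nat \<Rightarrow> nat \<Rightarrow> (nat \<Rightarrow> real) set \<Rightarrow> ((nat \<Rightarrow> real) \<Rightarrow> nat \<Rightarrow> real) \<Rightarrow> bool" where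
  "has_Q_FISCIDS_rep n m X \<phi> \<longleftrightarrow> (\<exists>N Z z0 F h. Q_FISCIDS_rep n m X \<phi> N Z z0 F h)"

end

theory Submission
  imports Defs "HOL-Computational_Algebra.Polynomial" "HOL-Library.Multiset"
begin

text \<open>
  The function is
  \<open>\<phi>(\<xi>\<^sub>0, \<xi>\<^sub>1) = \<integral>\<^sub>0\<^sup>1 exp (- \<xi>\<^sub>1 t) \<xi>\<^sub>0 / (2 + exp (- \<xi>\<^sub>0 t)) dt\<close>
  on the half plane \<open>\<xi>\<^sub>0 > 0\<close>.  Both factors of the integrand, as functions of \<open>t\<close>, and the
  integral itself are the states of a quadratic system, because \<open>g = 1 / (2 + exp (- u))\<close>
  satisfies \<open>g' = g - 2 g\<^sup>2\<close>.

  Fix \<open>\<xi>\<^sub>0 = b\<close> and write \<open>h\<^sub>k\<close> for the \<open>k\<close>-th derivative of \<open>\<phi>\<close> in \<open>x = \<xi>\<^sub>1\<close>.  Clearing the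
  denominator of the kernel gives \<open>h\<^sub>k(x + b) + 2 h\<^sub>k(x) = b (- 1)\<^sup>k k! / x\<^sup>k\<^sup>+\<^sup>1\<close> up to functions
  that decay faster than every power of \<open>x\<close>.  Modulo that ideal the argument of Hoelder for the
  Gamma function applies: comparing a shortest algebraic relation of least degree between the
  \<open>h\<^sub>k\<close> over the rational functions with its shift by \<open>b\<close> makes the leading coefficients constant,
  and the next lower degree then yields a rational \<open>q\<close> such that \<open>q(x + b) + 2 q(x)\<close> is a
  nonzero combination of the \<open>1 / x\<^sup>k\<^sup>+\<^sup>1\<close>.  This is impossible, since a pole of \<open>q\<close> at \<open>0\<close> or \<open>b\<close>
  would propagate to infinitely many points.
\<close>

subsection \<open>Rational germs at infinity and rapidly decaying functions\<close>

text \<open>These are the coefficients of algebraic relations. Only values near infinity count, so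
  poles do no harm, and up to eventual equality the germs form a field stable under shifts.\<close>

definition rat_germ :: "(real \<Rightarrow> real) \<Rightarrow> bool" where
  "rat_germ f \<longleftrightarrow> (\<exists>u v. v \<noteq> 0 \<and> (\<forall>\<^sub>F x in at_top. f x = poly u x / poly v x))"

text \<open>The class of negligible errors: it absorbs the terms with \<open>exp (- x)\<close> that
  come from cutting a Laplace integral off at 1, and it meets the rational germs only in
  zero.\<close>

definition rapid_decay :: "(real \<Rightarrow> real) \<Rightarrow> bool" where
  "rapid_decay f \<longleftrightarrow> (\<forall>k. ((\<lambda>x. x ^ k * f x) \<longlongrightarrow> 0) at_top)"

text \<open>A positive leading coefficient is itself an eventual lower bound; otherwise pass to
  \<open>- p\<close>. Besides non-vanishing this bounds reciprocals, as
  \<open>rapid_decay_rat_germ_mult\<close> requires.\<close>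

lemma poly_eventually_bounded_below:
  fixes p :: "real poly"
  assumes "p \<noteq> 0"
  shows "\<exists>c>0. \<forall>\<^sub>F x in at_top. c \<le> \<bar>poly p x\<bar>"
proof -
  have pos: "\<exists>c>0. \<forall>\<^sub>F x in at_top. c \<le> \<bar>poly q x\<bar>" if lc: "lead_coeff q > 0" for q :: "real poly"
  proof -
    obtain n where "\<forall>x\<ge>n. lead_coeff q \<le> poly q x"
      using poly_pinfty_gt_lc[OF lc] by blast
    then have "\<forall>x\<ge>n. lead_coeff q \<le> \<bar>poly q x\<bar>"
      by fastforce
    then show ?thesis
      using lc unfolding eventually_at_top_linorder by blast
  qed
  show ?thesis
  proof (cases "lead_coeff p > 0")
    case True
    then show ?thesis by (rule pos)
  next
    case False
    then have "lead_coeff (- p) > 0"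
      using assms by (simp add: linorder_not_less order_le_less)
    from pos[OF this] show ?thesis
      by simp
  qed
qed

lemma poly_eventually_nonzero:
  fixes p :: "real poly"
  assumes "p \<noteq> 0"
  shows "\<forall>\<^sub>F x in at_top. poly p x \<noteq> 0"
  using poly_eventually_bounded_below[OF assms] by (auto elim: eventually_mono)

lemma poly_eq_0_if_eventually:
  fixes p :: "real poly"
  assumes "\<forall>\<^sub>F x in at_top. poly p x = 0"
  shows "p = 0"
proof (rule ccontr)
  assume "p \<noteq> 0"
  then have "\<forall>\<^sub>F x::real in at_top. False"
    using eventually_conj[OF poly_eventually_nonzero[OF \<open>p \<noteq> 0\<close>] assms] by simp
  then show False by simp
qed

lemma rat_germI:
  assumes "v \<noteq> 0" "\<forall>\<^sub>F x in at_top. f x = poly u x / poly v x"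
  shows "rat_germ f"
  using assms unfolding rat_germ_def by blast

lemma rat_germ_poly: "rat_germ (poly u)"
  by (rule rat_germI[of 1 _ u]) auto

lemma rat_germ_const: "rat_germ (\<lambda>x. a)"
  by (rule rat_germI[of 1 _ "[:a:]"]) auto

lemma rat_germ_cong:
  assumes "rat_germ f" "\<forall>\<^sub>F x in at_top. g x = f x"
  shows "rat_germ g"
  using assms unfolding rat_germ_def by (force elim: eventually_elim2)

lemma rat_germ_add:
  assumes "rat_germ f" "rat_germ g"
  shows "rat_germ (\<lambda>x. f x + g x)"
proof -
  from assms obtain u v u' v' where
    uv: "v \<noteq> 0" "\<forall>\<^sub>F x in at_top. f x = poly u x / poly v x" and
    uv': "v' \<noteq> 0" "\<forall>\<^sub>F x in at_top. g x = poly u' x / poly v' x"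
    unfolding rat_germ_def by blast
  show ?thesis
  proof (rule rat_germI[of "v * v'" _ "u * v' + u' * v"])
    show "\<forall>\<^sub>F x in at_top. f x + g x = poly (u * v' + u' * v) x / poly (v * v') x"
      using uv(2) uv'(2) poly_eventually_nonzero[OF uv(1)] poly_eventually_nonzero[OF uv'(1)]
      by eventually_elim (simp add: field_simps)
  qed (use uv uv' in simp)
qed

lemma rat_germ_mult:
  assumes "rat_germ f" "rat_germ g"
  shows "rat_germ (\<lambda>x. f x * g x)"
proof -
  from assms obtain u v u' v' where
    uv: "v \<noteq> 0" "\<forall>\<^sub>F x in at_top. f x = poly u x / poly v x" and
    uv': "v' \<noteq> 0" "\<forall>\<^sub>F x in at_top. g x = poly u' x / poly v' x"
    unfolding rat_germ_def by blast
  show ?thesis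
  proof (rule rat_germI[of "v * v'" _ "u * u'"])
    show "\<forall>\<^sub>F x in at_top. f x * g x = poly (u * u') x / poly (v * v') x"
      using uv(2) uv'(2) by eventually_elim simp
  qed (use uv uv' in simp)
qed

lemma rat_germ_divide:
  assumes "rat_germ f" "rat_germ g"
  shows "rat_germ (\<lambda>x. f x / g x)"
proof -
  from assms obtain u v u' v' where
    uv: "v \<noteq> 0" "\<forall>\<^sub>F x in at_top. f x = poly u x / poly v x" and
    uv': "v' \<noteq> 0" "\<forall>\<^sub>F x in at_top. g x = poly u' x / poly v' x"
    unfolding rat_germ_def by blast
  show ?thesis
  proof (cases "u' = 0")
    case True
    \<comment> \<open>Here \<open>g\<close> is eventually 0, and division by 0 gives 0, so the
      quotient is the zero germ.\<close>
    show ?thesis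
      by (rule rat_germ_cong[OF rat_germ_const[of 0]]) (use uv'(2) True in \<open>auto elim: eventually_mono\<close>)
  next
    case False
    show ?thesis
    proof (rule rat_germI[of "v * u'" _ "u * v'"])
      show "\<forall>\<^sub>F x in at_top. f x / g x = poly (u * v') x / poly (v * u') x"
        using uv(2) uv'(2) by eventually_elim simp
    qed (use uv False in simp)
  qed
qed

lemma rat_germ_cmult: "rat_germ f \<Longrightarrow> rat_germ (\<lambda>x. a * f x)"
  using rat_germ_mult[OF rat_germ_const] .

lemma rat_germ_diff: "rat_germ f \<Longrightarrow> rat_germ g \<Longrightarrow> rat_germ (\<lambda>x. f x - g x)"
  using rat_germ_add[OF _ rat_germ_cmult[of g "-1"], of f] by simp

lemma rat_germ_sum: "(\<And>i. i \<in> A \<Longrightarrow> rat_germ (f i)) \<Longrightarrow> rat_germ (\<lambda>x. \<Sum>i\<in>A. f i x)"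
  by (induction A rule: infinite_finite_induct) (auto intro: rat_germ_const rat_germ_add)

lemma eventually_at_top_shift:
  fixes b :: real
  assumes "\<forall>\<^sub>F x in at_top. P x"
  shows "\<forall>\<^sub>F x in at_top. P (x + b)"
proof -
  obtain N where "\<forall>x\<ge>N. P x"
    using assms unfolding eventually_at_top_linorder by blast
  then have "\<forall>x\<ge>N - b. P (x + b)"
    by (simp add: algebra_simps)
  then show ?thesis
    unfolding eventually_at_top_linorder by blast
qed

lemma poly_shift: "poly (pcompose p [:b, 1:]) x = poly p (x + b)"
  for p :: "real poly"
  by (simp add: poly_pcompose add.commute)

lemma pcompose_shift_nonzero:
  fixes p :: "real poly"
  assumes "p \<noteq> 0"
  shows "pcompose p [:b, 1:] \<noteq> 0"
  using assms by (simp add: pcompose_eq_0_iff)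

lemma rat_germ_shift:
  assumes "rat_germ f"
  shows "rat_germ (\<lambda>x. f (x + b))"
proof -
  from assms obtain u v where
    uv: "v \<noteq> 0" "\<forall>\<^sub>F x in at_top. f x = poly u x / poly v x"
    unfolding rat_germ_def by blast
  show ?thesis
  proof (rule rat_germI[of "pcompose v [:b, 1:]" _ "pcompose u [:b, 1:]"])
    show "\<forall>\<^sub>F x in at_top. f (x + b) = poly (pcompose u [:b, 1:]) x / poly (pcompose v [:b, 1:]) x"
      using eventually_at_top_shift[OF uv(2), of b] by eventually_elim (simp add: poly_shift)
  qed (use uv pcompose_shift_nonzero in blast)
qed

text \<open>A nonzero numerator has finitely many roots. Hence a coefficient that is not eventually
  0 may be divided by.\<close>

lemma rat_germ_cases:
  assumes "rat_germ f"
  shows "(\<forall>\<^sub>F x in at_top. f x = 0) \<or> (\<forall>\<^sub>F x in at_top. f x \<noteq> 0)"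
proof -
  from assms obtain u v where
    uv: "v \<noteq> 0" "\<forall>\<^sub>F x in at_top. f x = poly u x / poly v x"
    unfolding rat_germ_def by blast
  show ?thesis
  proof (cases "u = 0")
    case True
    then show ?thesis
      using uv(2) by (auto elim: eventually_mono)
  next
    case False
    have "\<forall>\<^sub>F x in at_top. f x \<noteq> 0"
      using uv(2) poly_eventually_nonzero[OF uv(1)] poly_eventually_nonzero[OF False]
      by eventually_elim simp
    then show ?thesis ..
  qed
qed

section \<open>Stability of rapid decay\<close>

lemma rapid_decay_cong:
  assumes "rapid_decay f" "\<forall>\<^sub>F x in at_top. g x = f x"
  shows "rapid_decay g"
  unfolding rapid_decay_def
proof
  fix k
  have "((\<lambda>x. x ^ k * f x) \<longlongrightarrow> 0) at_top"
    using assms(1) unfolding rapid_decay_def by blast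
  moreover have "\<forall>\<^sub>F x in at_top. x ^ k * f x = x ^ k * g x"
    using assms(2) by eventually_elim simp
  ultimately show "((\<lambda>x. x ^ k * g x) \<longlongrightarrow> 0) at_top"
    by (rule Lim_transform_eventually)
qed

lemma rapid_decay_zero: "\<forall>\<^sub>F x in at_top. f x = 0 \<Longrightarrow> rapid_decay f"
  by (rule rapid_decay_cong[of "\<lambda>_. 0"]) (simp_all add: rapid_decay_def)

lemma rapid_decay_add: "rapid_decay f \<Longrightarrow> rapid_decay g \<Longrightarrow> rapid_decay (\<lambda>x. f x + g x)"
  unfolding rapid_decay_def by (auto simp: distrib_left intro!: tendsto_add_zero)

lemma rapid_decay_bounded_mult:
  assumes "rapid_decay f" "\<forall>\<^sub>F x in at_top. \<bar>g x\<bar> \<le> C"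
  shows "rapid_decay (\<lambda>x. g x * f x)"
  unfolding rapid_decay_def
proof
  fix k
  have "((\<lambda>x. C * (x ^ k * f x)) \<longlongrightarrow> 0) at_top"
    using assms(1) unfolding rapid_decay_def by (intro tendsto_mult_right_zero) blast
  then have "((\<lambda>x. \<bar>C * (x ^ k * f x)\<bar>) \<longlongrightarrow> 0) at_top"
    by (rule tendsto_rabs_zero)
  moreover have "\<forall>\<^sub>F x in at_top. norm (x ^ k * (g x * f x)) \<le> \<bar>C * (x ^ k * f x)\<bar>"
    using assms(2)
  proof eventually_elim
    case (elim x)
    then have "\<bar>g x\<bar> * \<bar>x ^ k * f x\<bar> \<le> \<bar>C\<bar> * \<bar>x ^ k * f x\<bar>"
      by (intro mult_right_mono) auto
    then show ?case
      by (simp add: abs_mult mult_ac)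
  qed
  ultimately show "((\<lambda>x. x ^ k * (g x * f x)) \<longlongrightarrow> 0) at_top"
    by (rule Lim_null_comparison[rotated])
qed

lemma rapid_decay_poly_mult:
  assumes "rapid_decay f"
  shows "rapid_decay (\<lambda>x. poly u x * f x)"
proof (induction u)
  case 0
  show ?case by (simp add: rapid_decay_zero)
next
  case (pCons a u)
  have "rapid_decay (\<lambda>x. x * (poly u x * f x))"
    unfolding rapid_decay_def
  proof
    fix k
    have "((\<lambda>x. x ^ Suc k * (poly u x * f x)) \<longlongrightarrow> 0) at_top"
      using pCons.IH unfolding rapid_decay_def by blast
    then show "((\<lambda>x. x ^ k * (x * (poly u x * f x))) \<longlongrightarrow> 0) at_top"
      by (simp add: mult_ac)
  qed
  moreover have "rapid_decay (\<lambda>x. a * f x)"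
    using assms by (rule rapid_decay_bounded_mult[where C = "\<bar>a\<bar>"]) simp
  ultimately have "rapid_decay (\<lambda>x. a * f x + x * (poly u x * f x))"
    by (rule rapid_decay_add[rotated])
  then show ?case
    by (simp add: algebra_simps)
qed

text \<open>The numerator only raises the power of \<open>x\<close>, and the reciprocal of the
  denominator is eventually bounded.\<close>

lemma rapid_decay_rat_germ_mult:
  assumes "rapid_decay f" "rat_germ c"
  shows "rapid_decay (\<lambda>x. c x * f x)"
proof -
  from assms(2) obtain u v where
    uv: "v \<noteq> 0" "\<forall>\<^sub>F x in at_top. c x = poly u x / poly v x"
    unfolding rat_germ_def by blast
  obtain e where e: "e > 0" "\<forall>\<^sub>F x in at_top. e \<le> \<bar>poly v x\<bar>"
    using poly_eventually_bounded_below[OF uv(1)] by blast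
  have "rapid_decay (\<lambda>x. (1 / poly v x) * (poly u x * f x))"
  proof (rule rapid_decay_bounded_mult[OF rapid_decay_poly_mult[OF assms(1)]])
    show "\<forall>\<^sub>F x in at_top. \<bar>1 / poly v x\<bar> \<le> 1 / e"
      using e(2) by eventually_elim (use e(1) in \<open>auto simp: abs_divide intro!: divide_left_mono mult_pos_pos\<close>)
  qed
  then show ?thesis
    by (rule rapid_decay_cong) (use uv(2) in \<open>auto elim: eventually_mono\<close>)
qed

lemma rapid_decay_shift:
  assumes "rapid_decay f" "b \<ge> 0"
  shows "rapid_decay (\<lambda>x. f (x + b))"
  unfolding rapid_decay_def
proof
  fix k
  have "((\<lambda>x. x ^ k * f x) \<longlongrightarrow> 0) at_top"
    using assms(1) unfolding rapid_decay_def by blast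
  then have "((\<lambda>x. (x + b) ^ k * f (x + b)) \<longlongrightarrow> 0) at_top"
    by (rule filterlim_compose)
      (subst add.commute, rule filterlim_tendsto_add_at_top[OF tendsto_const filterlim_ident])
  then have "((\<lambda>x. \<bar>(x + b) ^ k * f (x + b)\<bar>) \<longlongrightarrow> 0) at_top"
    by (rule tendsto_rabs_zero)
  moreover have "\<forall>\<^sub>F x in at_top. norm (x ^ k * f (x + b)) \<le> \<bar>(x + b) ^ k * f (x + b)\<bar>"
    using eventually_ge_at_top[of 0]
  proof eventually_elim
    case (elim x)
    then have "x ^ k * \<bar>f (x + b)\<bar> \<le> (x + b) ^ k * \<bar>f (x + b)\<bar>"
      using assms(2) by (intro mult_right_mono power_mono) auto
    then show ?case
      using elim assms(2) by (simp add: abs_mult)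
  qed
  ultimately show "((\<lambda>x. x ^ k * f (x + b)) \<longlongrightarrow> 0) at_top"
    by (rule Lim_null_comparison[rotated])
qed

text \<open>Multiplying by the denominator leaves a polynomial that tends to 0 at infinity, and only
  the zero polynomial does. This starts the induction on the degree.\<close>

lemma rat_germ_rapid_decay_zero:
  assumes "rat_germ f" "rapid_decay f"
  shows "\<forall>\<^sub>F x in at_top. f x = 0"
proof -
  from assms(1) obtain u v where
    uv: "v \<noteq> 0" "\<forall>\<^sub>F x in at_top. f x = poly u x / poly v x"
    unfolding rat_germ_def by blast
  have "rapid_decay (poly u)"
    by (rule rapid_decay_cong[OF rapid_decay_poly_mult[OF assms(2), of v]])
      (use uv(2) poly_eventually_nonzero[OF uv(1)] in eventually_elim, simp)
  then have lim: "(poly u \<longlongrightarrow> 0) at_top"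
    unfolding rapid_decay_def by (auto dest: spec[of _ 0])
  have "u = 0"
  proof (rule ccontr)
    assume "u \<noteq> 0"
    then obtain c where c: "c > 0" "\<forall>\<^sub>F x in at_top. c \<le> \<bar>poly u x\<bar>"
      using poly_eventually_bounded_below by blast
    have "\<forall>\<^sub>F x in at_top. \<bar>poly u x\<bar> < c"
      using tendstoD[OF lim c(1)] by (simp add: dist_real_def)
    with c(2) have "\<forall>\<^sub>F x::real in at_top. False"
      by eventually_elim simp
    then show False by simp
  qed
  then show ?thesis
    using uv(2) by simp
qed

section \<open>Shift equations for rational functions\<close>

lemma rat_germ_periodic_const:
  assumes "rat_germ f" "b > 0" "\<forall>\<^sub>F x in at_top. f (x + b) = f x"
  shows "\<exists>a. \<forall>\<^sub>F x in at_top. f x = a"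
proof -
  from assms(1) obtain u v where
    uv: "v \<noteq> 0" "\<forall>\<^sub>F x in at_top. f x = poly u x / poly v x"
    unfolding rat_germ_def by blast
  have "\<forall>\<^sub>F x in at_top. f (x + b) = f x \<and> f x = poly u x / poly v x \<and> poly v x \<noteq> 0"
    using assms(3) uv(2) poly_eventually_nonzero[OF uv(1)] by eventually_elim simp
  then obtain N where N: "\<And>x. x \<ge> N \<Longrightarrow> f (x + b) = f x \<and> f x = poly u x / poly v x \<and> poly v x \<noteq> 0"
    unfolding eventually_at_top_linorder by blast
  have per: "f (N + real n * b) = f N" for n
  proof (induction n)
    case (Suc n)
    have "f (N + real n * b + b) = f (N + real n * b)"
      using N[of "N + real n * b"] \<open>b > 0\<close> by simp
    then show ?case
      using Suc by (simp add: algebra_simps)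
  qed simp
  \<comment> \<open>\<open>w\<close> vanishes on the whole progression \<open>N + n b\<close>, so it
    is the zero polynomial and \<open>u / v\<close> is the constant \<open>f N\<close>.\<close>
  define w where "w = u - smult (f N) v"
  have "poly w (N + real n * b) = 0" for n
    using N[of "N + real n * b"] per[of n] \<open>b > 0\<close> by (simp add: w_def field_simps)
  then have "range (\<lambda>n. N + real n * b) \<subseteq> {x. poly w x = 0}"
    by auto
  moreover have "infinite (range (\<lambda>n. N + real n * b))"
    using \<open>b > 0\<close> by (intro range_inj_infinite) (auto simp: inj_on_def)
  ultimately have "w = 0"
    using poly_roots_finite finite_subset by blast
  then have u: "poly u x = f N * poly v x" for x
    by (simp add: w_def)
  have "f x = f N" if "x \<ge> N" for x
  proof -
    have "f x = poly u x / poly v x" "poly v x \<noteq> 0"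
      using N[OF that] by blast+
    then show ?thesis
      by (simp add: u)
  qed
  then have "\<forall>\<^sub>F x in at_top. f x = f N"
    unfolding eventually_at_top_linorder by blast
  then show ?thesis ..
qed

text \<open>Poles, expressed as local unboundedness, propagate in steps of \<open>b\<close>. The
  right side has a pole only at 0, so 0 or \<open>b\<close> is a pole of \<open>Q\<close>. A pole at
  \<open>b\<close> spreads to all \<open>b + n b\<close>, a pole at 0 to all \<open>- n b\<close>,
  but there are only finitely many.\<close>

lemma shift_equation_no_rational_solution:
  fixes u v w :: "real poly" and b s :: real
  assumes "b > 0" "s \<noteq> 0" "v \<noteq> 0" "poly w 0 \<noteq> 0"
    and ev: "\<forall>\<^sub>F x in at_top. poly u (x + b) / poly v (x + b) + s * (poly u x / poly v x) = poly w x / x ^ Suc m"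
  shows False
proof -
  define Q where "Q x = poly u x / poly v x" for x
  define R where "R x = poly w x / x ^ Suc m" for x
  define bdd where "bdd f a \<longleftrightarrow> (\<exists>K. \<forall>\<^sub>F x in at a. \<bar>f x\<bar> \<le> K)" for f :: "real \<Rightarrow> real" and a
  let ?sh = "\<lambda>p. pcompose p [:b, 1:]"
  \<comment> \<open>Clearing denominators turns the equation near infinity into a polynomial
    identity, which then holds at every real point, in particular near the poles.\<close>
  define W where "W = ?sh u * v * monom 1 (Suc m) + smult s (u * ?sh v * monom 1 (Suc m)) - w * v * ?sh v"
  have "?sh v \<noteq> 0"
    using pcompose_shift_nonzero[OF \<open>v \<noteq> 0\<close>] .
  have "\<forall>\<^sub>F x in at_top. poly W x = 0"
    using ev poly_eventually_nonzero[OF \<open>v \<noteq> 0\<close>] poly_eventually_nonzero[OF \<open>?sh v \<noteq> 0\<close>] eventually_gt_at_top[of 0]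
  proof eventually_elim
    case (elim x)
    then show ?case
      by (simp add: W_def poly_shift poly_monom divide_simps del: power_Suc) (simp add: algebra_simps)
  qed
  then have "W = 0"
    by (rule poly_eq_0_if_eventually)
  then have W: "poly u (x + b) * poly v x * x ^ Suc m + s * (poly u x * poly v (x + b) * x ^ Suc m) =
      poly w x * poly v x * poly v (x + b)" for x
  proof -
    have "poly W x = 0"
      using \<open>W = 0\<close> by simp
    then show ?thesis
      unfolding W_def by (simp add: poly_shift poly_monom mult_ac del: power_Suc)
  qed
  define Z where "Z = {x. poly (v * ?sh v * monom 1 1) x = 0}"
  have "finite Z"
    unfolding Z_def using \<open>v \<noteq> 0\<close> \<open>?sh v \<noteq> 0\<close> by (intro poly_roots_finite) simp
  have eqn: "\<forall>\<^sub>F x in at a. Q (x + b) + s * Q x = R x" for a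
  proof -
    have "\<forall>\<^sub>F x in at a. x \<notin> Z"
      using islimpt_finite[OF \<open>finite Z\<close>, of a] islimpt_iff_eventually by blast
    then show ?thesis
    proof eventually_elim
      case (elim x)
      then have "poly v x \<noteq> 0" "poly v (x + b) \<noteq> 0" "x \<noteq> 0"
        by (auto simp: Z_def poly_shift poly_monom)
      then show ?case
        using W[of x] by (simp add: Q_def R_def divide_simps del: power_Suc) (simp add: algebra_simps)
    qed
  qed
  have sub: "bdd g a" if "bdd f a" "bdd h a" "\<forall>\<^sub>F x in at a. g x = \<alpha> * f x + \<beta> * h x" for f g h a \<alpha> \<beta>
  proof -
    obtain K L where KL: "\<forall>\<^sub>F x in at a. \<bar>f x\<bar> \<le> K" "\<forall>\<^sub>F x in at a. \<bar>h x\<bar> \<le> L"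
      using \<open>bdd f a\<close> \<open>bdd h a\<close> unfolding bdd_def by blast
    have "\<forall>\<^sub>F x in at a. \<bar>g x\<bar> \<le> \<bar>\<alpha>\<bar> * K + \<bar>\<beta>\<bar> * L"
      using KL that(3)
    proof eventually_elim
      case (elim x)
      have "\<bar>g x\<bar> \<le> \<bar>\<alpha>\<bar> * \<bar>f x\<bar> + \<bar>\<beta>\<bar> * \<bar>h x\<bar>"
        unfolding elim(3) by (metis abs_mult abs_triangle_ineq)
      also have "\<dots> \<le> \<bar>\<alpha>\<bar> * K + \<bar>\<beta>\<bar> * L"
        using elim by (intro add_mono mult_left_mono) auto
      finally show ?case .
    qed
    then show ?thesis unfolding bdd_def by blast
  qed
  have cont: "bdd f a" if "isCont f a" for f a
  proof -
    have "((\<lambda>x. \<bar>f x\<bar>) \<longlongrightarrow> \<bar>f a\<bar>) (at a)"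
      using that by (intro tendsto_rabs) (simp add: isCont_def)
    then have "\<forall>\<^sub>F x in at a. \<bar>f x\<bar> < \<bar>f a\<bar> + 1"
      by (rule order_tendstoD) simp
    then show ?thesis
      unfolding bdd_def by (meson eventually_mono less_imp_le)
  qed
  have shift: "bdd (\<lambda>x. Q (x + b)) a \<longleftrightarrow> bdd Q (a + b)" for a
  proof -
    have "at (a + b) = filtermap (\<lambda>x. x + b) (at a)"
      using filtermap_at_shift[of "- b" a] by simp
    then show ?thesis
      unfolding bdd_def by (simp add: eventually_filtermap)
  qed
  have bdd_R: "bdd R a" if "a \<noteq> 0" for a
    using that unfolding R_def by (intro cont continuous_intros) auto
  have step: "bdd Q (a + b) \<longleftrightarrow> bdd Q a" if "a \<noteq> 0" for a
  proof
    assume "bdd Q (a + b)"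
    then have "bdd (\<lambda>x. Q (x + b)) a" by (simp add: shift)
    then show "bdd Q a"
      by (rule sub[OF bdd_R[OF that], where \<alpha> = "1 / s" and \<beta> = "- 1 / s"])
        (use eqn[of a] in eventually_elim, use \<open>s \<noteq> 0\<close> in \<open>simp add: field_simps\<close>)
  next
    assume "bdd Q a"
    then have "bdd (\<lambda>x. Q (x + b)) a"
      by (rule sub[OF bdd_R[OF that], where \<alpha> = 1 and \<beta> = "- s"])
        (use eqn[of a] in eventually_elim, simp add: algebra_simps)
    then show "bdd Q (a + b)" by (simp add: shift)
  qed
  have poles: "finite {a. \<not> bdd Q a}"
  proof (rule finite_subset)
    show "{a. \<not> bdd Q a} \<subseteq> {a. poly v a = 0}"
    proof (clarify, rule ccontr)
      fix a assume "\<not> bdd Q a" "poly v a \<noteq> 0"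
      then show False
        using cont[of a Q] unfolding Q_def by (auto intro!: continuous_intros)
    qed
    show "finite {a. poly v a = 0}"
      using \<open>v \<noteq> 0\<close> by (rule poly_roots_finite)
  qed
  \<comment> \<open>If \<open>R\<close> were bounded at 0, then
    \<open>poly w x = x ^ Suc m * R x\<close> would tend to 0, contrary to
    \<open>poly w 0 \<noteq> 0\<close>.\<close>
  have "\<not> bdd R 0"
  proof
    assume "bdd R 0"
    then obtain K where K: "\<forall>\<^sub>F x in at 0. \<bar>R x\<bar> \<le> K"
      unfolding bdd_def by blast
    have "((\<lambda>x. \<bar>x ^ Suc m\<bar> * K) \<longlongrightarrow> \<bar>0 ^ Suc m\<bar> * K) (at 0)"
      by (intro tendsto_intros)
    then have "((\<lambda>x. \<bar>x ^ Suc m\<bar> * K) \<longlongrightarrow> 0) (at 0)"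
      by simp
    moreover have "\<forall>\<^sub>F x in at 0. norm (poly w x) \<le> \<bar>x ^ Suc m\<bar> * K"
      using K eventually_neq_at_within[of 0 0 UNIV]
    proof eventually_elim
      case (elim x)
      have "\<bar>poly w x\<bar> = \<bar>x ^ Suc m\<bar> * \<bar>R x\<bar>"
        using elim(2) by (simp add: R_def abs_mult abs_divide)
      also have "\<dots> \<le> \<bar>x ^ Suc m\<bar> * K"
        using elim(1) by (intro mult_left_mono) auto
      finally show ?case by simp
    qed
    ultimately have "(poly w \<longlongrightarrow> 0) (at 0)"
      by (rule Lim_null_comparison[rotated])
    moreover have "(poly w \<longlongrightarrow> poly w 0) (at 0)"
      using poly_isCont[of 0 w] by (simp add: isCont_def)
    ultimately show False
      using \<open>poly w 0 \<noteq> 0\<close> tendsto_unique[OF at_neq_bot] by blast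
  qed
  then have "\<not> bdd Q b \<or> \<not> bdd Q 0"
  proof (rule contrapos_np)
    assume "\<not> (\<not> bdd Q b \<or> \<not> bdd Q 0)"
    then have "bdd (\<lambda>x. Q (x + b)) 0" "bdd Q 0"
      using shift[of 0] by auto
    then show "bdd R 0"
      by (rule sub[where \<alpha> = 1 and \<beta> = s]) (use eqn[of 0] in eventually_elim, simp)
  qed
  then show False
  proof
    assume ub: "\<not> bdd Q b"
    have "\<not> bdd Q (b + real n * b)" for n
    proof (induction n)
      case (Suc n)
      have "b + real n * b > 0"
        using \<open>b > 0\<close> by (simp add: add_pos_nonneg)
      then show ?case
        using step[of "b + real n * b"] Suc by (simp add: algebra_simps)
    qed (use ub in simp)
    then have "range (\<lambda>n. b + real n * b) \<subseteq> {a. \<not> bdd Q a}"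
      by auto
    moreover have "infinite (range (\<lambda>n. b + real n * b))"
      using \<open>b > 0\<close> by (intro range_inj_infinite) (auto simp: inj_on_def)
    ultimately show False
      using poles finite_subset by blast
  next
    assume ub: "\<not> bdd Q 0"
    have "\<not> bdd Q (- (real n * b))" for n
    proof (induction n)
      case (Suc n)
      have "- (real (Suc n) * b) \<noteq> 0"
        using \<open>b > 0\<close> by simp
      then show ?case
        using step[of "- (real (Suc n) * b)"] Suc by (simp add: algebra_simps)
    qed (use ub in simp)
    then have "range (\<lambda>n. - (real n * b)) \<subseteq> {a. \<not> bdd Q a}"
      by auto
    moreover have "infinite (range (\<lambda>n. - (real n * b)))"
      using \<open>b > 0\<close> by (intro range_inj_infinite) (auto simp: inj_on_def)
    ultimately show False
      using poles finite_subset by blast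
  qed
qed

subsection \<open>Algebraic independence from a shift equation\<close>

text \<open>Over the common denominator \<open>x ^ Suc m\<close>, with \<open>m\<close> the largest
  index whose coefficient is nonzero, the numerator takes the value \<open>l m\<close> at 0. So the
  pole at 0 survives, and \<open>shift_equation_no_rational_solution\<close> applies with
  \<open>- s\<close>.\<close>

lemma rat_germ_pole_equation_unsolvable:
  fixes b s :: real and l :: "nat \<Rightarrow> real"
  assumes "b > 0" "s \<noteq> 0" "finite J" "j \<in> J" "l j \<noteq> 0" "rat_germ q"
    and ev: "\<forall>\<^sub>F x in at_top. (\<Sum>i\<in>J. l i / x ^ Suc i) = q (x + b) - s * q x"
  shows False
proof -
  define L where "L = {i \<in> J. l i \<noteq> 0}"
  have L: "finite L" "L \<noteq> {}"
    using assms by (auto simp: L_def)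
  define m where "m = Max L"
  have m: "m \<in> L" "\<And>i. i \<in> L \<Longrightarrow> i \<le> m"
    using L by (auto simp: m_def)
  define w where "w = (\<Sum>i\<in>L. monom (l i) (m - i))"
  have "poly w 0 = (\<Sum>i\<in>L. if i = m then l i else 0)"
    unfolding w_def poly_sum poly_monom
  proof (intro sum.cong refl)
    fix i assume "i \<in> L"
    then have "m - i = 0 \<longleftrightarrow> i = m"
      using m(2)[of i] by auto
    then show "l i * 0 ^ (m - i) = (if i = m then l i else 0)"
      by (simp add: power_0_left)
  qed
  also have "\<dots> = l m"
    using L m by simp
  finally have "poly w 0 \<noteq> 0"
    using m(1) by (simp add: L_def)
  have w: "(\<Sum>i\<in>J. l i / x ^ Suc i) = poly w x / x ^ Suc m" if "x > 0" for x
  proof -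
    have "(\<Sum>i\<in>J. l i / x ^ Suc i) = (\<Sum>i\<in>L. l i / x ^ Suc i)"
      using \<open>finite J\<close> by (intro sum.mono_neutral_right) (auto simp: L_def)
    also have "\<dots> = (\<Sum>i\<in>L. l i * x ^ (m - i) / x ^ Suc m)"
    proof (intro sum.cong refl)
      fix i assume "i \<in> L"
      then have "x ^ Suc m = x ^ Suc i * x ^ (m - i)"
        using m(2) by (simp flip: power_add)
      then show "l i / x ^ Suc i = l i * x ^ (m - i) / x ^ Suc m"
        using that by simp
    qed
    also have "\<dots> = poly w x / x ^ Suc m"
      by (simp add: w_def poly_sum poly_monom sum_divide_distrib)
    finally show ?thesis .
  qed
  from \<open>rat_germ q\<close> obtain u v where
    uv: "v \<noteq> 0" "\<forall>\<^sub>F x in at_top. q x = poly u x / poly v x"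
    unfolding rat_germ_def by blast
  have "\<forall>\<^sub>F x in at_top. poly u (x + b) / poly v (x + b) + (- s) * (poly u x / poly v x) = poly w x / x ^ Suc m"
    using ev uv(2) eventually_at_top_shift[OF uv(2), of b] eventually_gt_at_top[of 0]
    by eventually_elim (simp add: w[symmetric] del: power_Suc)
  then show False
    using shift_equation_no_rational_solution[of b "- s" v w u m] assms(1,2) uv(1) \<open>poly w 0 \<noteq> 0\<close> by simp
qed

lemma sum_mset_eq_sum_count:
  fixes f :: "'a \<Rightarrow> real"
  shows "(\<Sum>i\<in>#M. f i) = (\<Sum>i\<in>set_mset M. real (count M i) * f i)"
proof -
  have "(\<Sum>i\<in>#M. f i) = (\<Sum>i\<in>T. real (count M i) * f i)" if "finite T" "set_mset M \<subseteq> T" for T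
    using that(2)
  proof (induction M)
    case (add a M)
    have "(\<Sum>i\<in>T. real (count (add_mset a M) i) * f i) =
        (\<Sum>i\<in>T. (if i = a then f i else 0) + real (count M i) * f i)"
      by (intro sum.cong refl) (simp add: distrib_right)
    also have "\<dots> = f a + (\<Sum>i\<in>#M. f i)"
      using add \<open>finite T\<close> by (simp add: sum.distrib)
    finally show ?case by simp
  qed simp
  then show ?thesis by simp
qed

text \<open>What Hoelder's argument uses of the derivatives \<open>h k\<close>. The functional
  equation holds only up to rapid decay; boundedness of \<open>h k\<close> keeps such errors
  negligible after multiplication by monomials.\<close>

locale shift_system =
  fixes h :: "nat \<Rightarrow> real \<Rightarrow> real" and \<rho> :: "nat \<Rightarrow> real" and b s :: real
  assumes b_pos: "b > 0" and s_nonzero: "s \<noteq> 0" and \<rho>_nonzero: "\<rho> k \<noteq> 0"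
    and h_bounded: "\<exists>C. \<forall>\<^sub>F x in at_top. \<bar>h k x\<bar> \<le> C"
    and h_shift: "rapid_decay (\<lambda>x. h k (x + b) - (\<rho> k / x ^ Suc k + s * h k x))"
begin

definition r :: "nat \<Rightarrow> real \<Rightarrow> real" where
  "r k x = \<rho> k / x ^ Suc k"

text \<open>A monomial in the \<open>h i\<close> is encoded by the multiset of its indices, so its
  degree is \<open>size\<close> and division by a variable is removal of an element.\<close>

definition H :: "nat multiset \<Rightarrow> real \<Rightarrow> real" where
  "H M x = (\<Prod>i\<in>#M. h i x)"

text \<open>The derivation sending \<open>h i\<close> to \<open>r i\<close>, applied to a monomial.
  Up to a power of \<open>s\<close> it is the second highest homogeneous part in the expansion of
  the product of the factors \<open>r i + s * h i\<close>.\<close>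

definition D :: "nat multiset \<Rightarrow> real \<Rightarrow> real" where
  "D M x = (\<Sum>i\<in>#M. r i x * H (M - {#i#}) x)"

text \<open>Expressions of degree less than \<open>d\<close> in the \<open>h i\<close> over the
  rational germs, modulo rapid decay; \<open>low 0\<close> is rapid decay itself.\<close>

inductive low :: "nat \<Rightarrow> (real \<Rightarrow> real) \<Rightarrow> bool" for d where
  low_rapid: "rapid_decay f \<Longrightarrow> low d f"
| low_monomial: "rat_germ c \<Longrightarrow> size M < d \<Longrightarrow> low d (\<lambda>x. c x * H M x)"
| low_add: "low d f \<Longrightarrow> low d g \<Longrightarrow> low d (\<lambda>x. f x + g x)"

section \<open>Calculus of lower-order terms\<close>

lemma H_empty [simp]: "H {#} x = 1"
  by (simp add: H_def)

lemma H_add_mset [simp]: "H (add_mset a M) x = h a x * H M x"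
  by (simp add: H_def)

lemma rat_germ_r: "rat_germ (r k)"
proof -
  have "rat_germ (\<lambda>x. \<rho> k / poly (monom 1 (Suc k)) x)"
    by (intro rat_germ_divide rat_germ_const rat_germ_poly)
  then show ?thesis
    by (rule rat_germ_cong) (simp add: r_def poly_monom)
qed

lemma H_bounded: "\<exists>C. \<forall>\<^sub>F x in at_top. \<bar>H M x\<bar> \<le> C"
proof (induction M)
  case empty
  show ?case by (auto intro: exI[of _ 1])
next
  case (add a M)
  then obtain C C' where C: "\<forall>\<^sub>F x in at_top. \<bar>H M x\<bar> \<le> C" "\<forall>\<^sub>F x in at_top. \<bar>h a x\<bar> \<le> C'"
    using h_bounded by blast
  have "\<forall>\<^sub>F x in at_top. \<bar>H (add_mset a M) x\<bar> \<le> C' * C"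
    using C by eventually_elim (auto simp: abs_mult intro: mult_mono)
  then show ?case ..
qed

lemma low_cong:
  assumes "low d f" "\<forall>\<^sub>F x in at_top. g x = f x"
  shows "low d g"
proof -
  have "rapid_decay (\<lambda>x. g x - f x)"
    using assms(2) by (intro rapid_decay_zero) (auto elim: eventually_mono)
  then have "low d (\<lambda>x. f x + (g x - f x))"
    by (rule low_add[OF assms(1) low_rapid])
  then show ?thesis by simp
qed

lemma low_mult:
  assumes "low d f" "rat_germ a"
  shows "low d (\<lambda>x. a x * f x)"
  using assms(1)
proof induction
  case (low_rapid f)
  then show ?case
    using assms(2) by (intro low.low_rapid rapid_decay_rat_germ_mult)
next
  case (low_monomial c M)
  then have "low d (\<lambda>x. (a x * c x) * H M x)"
    using assms(2) by (intro low.low_monomial rat_germ_mult)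
  then show ?case by (simp add: mult_ac)
next
  case (low_add f g)
  then have "low d (\<lambda>x. a x * f x + a x * g x)"
    by (intro low.low_add)
  then show ?case by (simp add: distrib_left)
qed

lemma low_cmult: "low d f \<Longrightarrow> low d (\<lambda>x. a * f x)"
  by (rule low_mult[OF _ rat_germ_const])

lemma low_diff: "low d f \<Longrightarrow> low d g \<Longrightarrow> low d (\<lambda>x. f x - g x)"
  using low_add[OF _ low_cmult[of d g "-1"], of f] by simp

lemma low_zero: "low d (\<lambda>x. 0)"
  by (intro low_rapid rapid_decay_zero) simp

lemma low_sum: "(\<And>i. i \<in> A \<Longrightarrow> low d (f i)) \<Longrightarrow> low d (\<lambda>x. \<Sum>i\<in>A. f i x)"
  by (induction A rule: infinite_finite_induct) (auto intro: low_zero low_add)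

lemma low_mono: "low d f \<Longrightarrow> d \<le> d' \<Longrightarrow> low d' f"
  by (induction rule: low.induct) (auto intro: low.intros)

text \<open>A monomial gains one in degree, and a rapidly decaying part stays negligible because
  \<open>h a\<close> is bounded.\<close>

lemma low_h_mult:
  assumes "low d f"
  shows "low (Suc d) (\<lambda>x. h a x * f x)"
  using assms
proof induction
  case (low_rapid f)
  obtain C where "\<forall>\<^sub>F x in at_top. \<bar>h a x\<bar> \<le> C"
    using h_bounded by blast
  then show ?case
    using low_rapid by (intro low.low_rapid rapid_decay_bounded_mult)
next
  case (low_monomial c M)
  then have "low (Suc d) (\<lambda>x. c x * H (add_mset a M) x)"
    by (intro low.low_monomial) auto
  then show ?case by (simp add: mult_ac)
next
  case (low_add f g)
  then have "low (Suc d) (\<lambda>x. h a x * f x + h a x * g x)"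
    by (intro low.low_add)
  then show ?case by (simp add: distrib_left)
qed

lemma low_D: "low (size M) (D M)"
proof -
  have "low (size M) (\<lambda>x. \<Sum>i\<in>#A. r i x * H (M - {#i#}) x)" if "set_mset A \<subseteq> set_mset M" for A
    using that
  proof (induction A)
    case empty
    show ?case by (simp add: low_zero)
  next
    case (add i A)
    then have "size (M - {#i#}) < size M"
      by (simp add: size_Diff1_less)
    then show ?case
      using add by (auto intro!: low_add low_monomial rat_germ_r)
  qed
  from this[of M] show ?thesis
    by (simp add: D_def[abs_def])
qed

lemma D_empty [simp]: "D {#} x = 0"
  by (simp add: D_def)

lemma D_add_mset: "D (add_mset a M) x = r a x * H M x + h a x * D M x"
proof -
  have "(\<Sum>i\<in>#M. r i x * H (add_mset a M - {#i#}) x) = (\<Sum>i\<in>#M. h a x * (r i x * H (M - {#i#}) x))"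
    by (rule arg_cong[where f = sum_mset], rule image_mset_cong) (simp flip: add_mset_remove_trivial_If)
  then show ?thesis
    by (simp add: D_def sum_mset_distrib_left)
qed

lemma D_eq_sum: "D M x = (\<Sum>i\<in>set_mset M. real (count M i) * (r i x * H (M - {#i#}) x))"
  unfolding D_def by (rule sum_mset_eq_sum_count)

text \<open>Multiply out the factors \<open>r i + s * h i\<close>: with \<open>n = size M\<close>,
  degree \<open>n\<close> contributes \<open>s ^ n * H M\<close>, degree \<open>n - 1\<close>
  contributes \<open>s ^ n / s * D M\<close>, and what is left has degree at most
  \<open>n - 2\<close>. Dividing by \<open>s\<close> avoids a truncated exponent.\<close>

lemma shift_H: "low (size M - 1) (\<lambda>x. H M (x + b) - s ^ size M * (H M x + D M x / s))"
proof (induction M)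
  case empty
  show ?case by (simp add: low_zero)
next
  case (add a M)
  define \<epsilon> where "\<epsilon> x = h a (x + b) - (r a x + s * h a x)" for x
  have \<epsilon>: "rapid_decay \<epsilon>"
    unfolding \<epsilon>_def[abs_def] r_def by (rule h_shift)
  show ?case
  proof (cases "M = {#}")
    case True
    \<comment> \<open>For a single factor the bound is \<open>low 0\<close>, so the error itself
      must decay rapidly.\<close>
    have "low (size (add_mset a M) - 1) \<epsilon>"
      using \<epsilon> by (rule low_rapid)
    then show ?thesis
      by (rule low_cong) (use True s_nonzero in \<open>simp add: D_add_mset \<epsilon>_def algebra_simps\<close>)
  next
    case False
    define n where "n = size M"
    have n: "Suc (n - 1) = n"
      using False by (simp add: n_def nonempty_has_size)
    define E where "E x = H M (x + b) - s ^ n * (H M x + D M x / s)" for x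
    have E: "low (n - 1) E"
      using add by (simp add: E_def[abs_def] n_def)
    obtain C where "\<forall>\<^sub>F x in at_top. \<bar>H M x\<bar> \<le> C"
      using H_bounded by blast
    then have C: "\<forall>\<^sub>F x in at_top. \<bar>H M (x + b)\<bar> \<le> C"
      by (rule eventually_at_top_shift)
    have "low n (\<lambda>x. s ^ n / s * (r a x * D M x))"
      unfolding n_def by (intro low_cmult low_mult low_D rat_germ_r)
    moreover have "low n (\<lambda>x. r a x * E x)"
      using E by (intro low_mult rat_germ_r) (erule low_mono, simp)
    moreover have "low n (\<lambda>x. s * (h a x * E x))"
      using low_h_mult[OF E, of a] n by (intro low_cmult) simp
    moreover have "low n (\<lambda>x. H M (x + b) * \<epsilon> x)"
      by (intro low_rapid rapid_decay_bounded_mult[OF \<epsilon> C])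
    \<comment> \<open>These four terms remain of
      \<open>(r a + s * h a + \<epsilon>) * H M (x + b)\<close>, with
      \<open>H M (x + b) = E + s ^ n * (H M + D M / s)\<close>, once the parts of degree
      \<open>Suc n\<close> and \<open>n\<close> are taken out.\<close>
    ultimately have "low n (\<lambda>x. s ^ n / s * (r a x * D M x) + r a x * E x + s * (h a x * E x) + H M (x + b) * \<epsilon> x)"
      by (intro low_add)
    also have "(\<lambda>x. s ^ n / s * (r a x * D M x) + r a x * E x + s * (h a x * E x) + H M (x + b) * \<epsilon> x) =
        (\<lambda>x. H (add_mset a M) (x + b) - s ^ Suc n * (H (add_mset a M) x + D (add_mset a M) x / s))"
      using s_nonzero by (intro ext) (simp add: E_def \<epsilon>_def D_add_mset field_simps)
    finally show ?thesis
      by (simp add: n_def)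
  qed
qed

lemma shift_H_leading: "low (size M) (\<lambda>x. H M (x + b) - s ^ size M * H M x)"
proof -
  have "low (size M) (\<lambda>x. (H M (x + b) - s ^ size M * (H M x + D M x / s)) + s ^ size M / s * D M x)"
    by (intro low_add low_cmult low_D low_mono[OF shift_H]) simp
  then show ?thesis
    by (simp add: algebra_simps)
qed

text \<open>The leading part of \<open>H M (x + b)\<close> is \<open>s ^ size M * H M x\<close>, so
  a shift never raises the degree.\<close>

lemma low_shift:
  assumes "low d f"
  shows "low d (\<lambda>x. f (x + b))"
  using assms
proof induction
  case (low_rapid f)
  then show ?case
    using b_pos by (intro low.low_rapid rapid_decay_shift) simp_all
next
  case (low_monomial c M)
  have "low d (\<lambda>x. c (x + b) * (H M (x + b) - s ^ size M * H M x) + (s ^ size M * c (x + b)) * H M x)"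
    using low_monomial
    by (intro low_add low_mult rat_germ_shift low.low_monomial rat_germ_cmult low_mono[OF shift_H_leading]) simp_all
  then show ?case
    by (simp add: algebra_simps)
next
  case (low_add f g)
  then show ?case
    by (intro low.low_add)
qed

lemma low_0_rapid:
  assumes "low 0 f"
  shows "rapid_decay f"
  using assms by induction (auto intro: rapid_decay_add)

text \<open>Splits off the homogeneous part of degree \<open>d\<close>. The coefficient family is
  zero outside its finite support, so that the parts of a sum can be added over the union of the
  supports.\<close>

lemma low_Suc_leading:
  assumes "low (Suc d) f"
  shows "\<exists>Q q. finite Q \<and> (\<forall>N\<in>Q. size N = d) \<and> (\<forall>N. rat_germ (q N)) \<and> (\<forall>N. N \<notin> Q \<longrightarrow> q N = (\<lambda>_. 0)) \<and>
    low d (\<lambda>x. f x - (\<Sum>N\<in>Q. q N x * H N x))"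
  using assms
proof induction
  case (low_rapid f)
  then show ?case
    by (intro exI[of _ "{}"] exI[of _ "\<lambda>_ _. 0"]) (auto intro: low.low_rapid rat_germ_const)
next
  case (low_monomial c M)
  show ?case
  proof (cases "size M = d")
    case True
    then show ?thesis
      using low_monomial by (intro exI[of _ "{M}"] exI[of _ "\<lambda>N. if N = M then c else (\<lambda>_. 0)"])
        (auto intro: low_zero rat_germ_const)
  next
    case False
    then show ?thesis
      using low_monomial by (intro exI[of _ "{}"] exI[of _ "\<lambda>_ _. 0"])
        (auto intro: low.low_monomial rat_germ_const)
  qed
next
  case (low_add f g)
  then obtain Q q Q' q' where
    Q: "finite Q" "\<forall>N\<in>Q. size N = d" "\<forall>N. rat_germ (q N)" "\<forall>N. N \<notin> Q \<longrightarrow> q N = (\<lambda>_. 0)"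
      "low d (\<lambda>x. f x - (\<Sum>N\<in>Q. q N x * H N x))" and
    Q': "finite Q'" "\<forall>N\<in>Q'. size N = d" "\<forall>N. rat_germ (q' N)" "\<forall>N. N \<notin> Q' \<longrightarrow> q' N = (\<lambda>_. 0)"
      "low d (\<lambda>x. g x - (\<Sum>N\<in>Q'. q' N x * H N x))"
    by (elim exE conjE) blast
  have "(\<Sum>N\<in>Q \<union> Q'. (q N x + q' N x) * H N x) = (\<Sum>N\<in>Q. q N x * H N x) + (\<Sum>N\<in>Q'. q' N x * H N x)" for x
  proof -
    have "(\<Sum>N\<in>Q. q N x * H N x) = (\<Sum>N\<in>Q \<union> Q'. q N x * H N x)"
      using Q Q' by (intro sum.mono_neutral_left) auto
    moreover have "(\<Sum>N\<in>Q'. q' N x * H N x) = (\<Sum>N\<in>Q \<union> Q'. q' N x * H N x)"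
      using Q Q' by (intro sum.mono_neutral_left) auto
    ultimately show ?thesis
      by (simp add: distrib_right sum.distrib)
  qed
  moreover have "low d (\<lambda>x. (f x - (\<Sum>N\<in>Q. q N x * H N x)) + (g x - (\<Sum>N\<in>Q'. q' N x * H N x)))"
    using Q(5) Q'(5) by (rule low.low_add)
  ultimately have "low d (\<lambda>x. f x + g x - (\<Sum>N\<in>Q \<union> Q'. (q N x + q' N x) * H N x))"
    by (simp add: algebra_simps)
  then show ?case
    using Q Q' by (intro exI[of _ "Q \<union> Q'"] exI[of _ "\<lambda>N x. q N x + q' N x"]) (auto intro: rat_germ_add)
qed

section \<open>Hoelder's induction on the degree\<close>

text \<open>Relations are homogeneous of degree \<open>d\<close> and hold modulo lower degree and
  rapid decay; in this form they may be shifted and multiplied by rational germs.\<close>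

definition indep :: "nat \<Rightarrow> bool" where
  "indep d \<longleftrightarrow> (\<forall>S c. finite S \<longrightarrow> (\<forall>M\<in>S. size M = d \<and> rat_germ (c M)) \<longrightarrow>
     low d (\<lambda>x. \<Sum>M\<in>S. c M x * H M x) \<longrightarrow> (\<forall>M\<in>S. \<forall>\<^sub>F x in at_top. c M x = 0))"

lemma indepD:
  assumes "indep d" "finite S" "\<forall>M\<in>S. size M = d \<and> rat_germ (c M)"
    and "low d (\<lambda>x. \<Sum>M\<in>S. c M x * H M x)"
  shows "\<forall>M\<in>S. \<forall>\<^sub>F x in at_top. c M x = 0"
  using assms(1)[unfolded indep_def, rule_format, of S c] assms(2-4) by blast

lemma indep_0: "indep 0"
  unfolding indep_def
proof (intro allI impI ballI)
  fix S :: "nat multiset set" and c M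
  assume S: "finite S" "\<forall>M\<in>S. size M = 0 \<and> rat_germ (c M)" "low 0 (\<lambda>x. \<Sum>M\<in>S. c M x * H M x)" "M \<in> S"
  then have "M = {#}" "S = {{#}}"
    by auto
  then show "\<forall>\<^sub>F x in at_top. c M x = 0"
    using S low_0_rapid[OF S(3)] by (intro rat_germ_rapid_decay_zero) simp_all
qed

text \<open>Subtract \<open>s ^ Suc d\<close> times the relation from its shift. The part of degree
  \<open>Suc d\<close> cancels; up to the factor \<open>s ^ d\<close>, degree \<open>d\<close>
  retains \<open>D\<close> of the leading part minus the terms
  \<open>(q N (x + b) - s * q N x) * H N x\<close>. Independence in degree \<open>d\<close> makes
  every coefficient vanish, and one of these equations is a pole equation without rational
  solution.\<close>

lemma no_constant_relation:
  fixes \<kappa> :: "nat multiset \<Rightarrow> real"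
  assumes "indep d" "finite S" "\<forall>M\<in>S. size M = Suc d" "M0 \<in> S" "\<kappa> M0 \<noteq> 0"
    and A: "low (Suc d) (\<lambda>x. \<Sum>M\<in>S. \<kappa> M * H M x)"
  shows False
proof -
  obtain Q q where
    Q: "finite Q" "\<forall>N\<in>Q. size N = d" "\<forall>N. rat_germ (q N)" "\<forall>N. N \<notin> Q \<longrightarrow> q N = (\<lambda>_. 0)"
      "low d (\<lambda>x. (\<Sum>M\<in>S. \<kappa> M * H M x) - (\<Sum>N\<in>Q. q N x * H N x))"
    using low_Suc_leading[OF A] by (elim exE conjE) blast
  define R where "R x = (\<Sum>M\<in>S. \<kappa> M * H M x) - (\<Sum>N\<in>Q. q N x * H N x)" for x
  define E where "E M x = H M (x + b) - s ^ Suc d * (H M x + D M x / s)" for M x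
  define E' where "E' N x = H N (x + b) - s ^ d * H N x" for N x
  have "low d R"
    using Q(5) by (simp add: R_def[abs_def])
  have E: "low d (E M)" if "M \<in> S" for M
    using shift_H[of M] assms(3) that by (simp add: E_def[abs_def])
  have E': "low d (E' N)" if "N \<in> Q" for N
    using shift_H_leading[of N] Q(2) that by (simp add: E'_def[abs_def])
  have "low d (\<lambda>x. (1 / s ^ d) * (R (x + b) - s ^ Suc d * R x - (\<Sum>M\<in>S. \<kappa> M * E M x) + (\<Sum>N\<in>Q. q N (x + b) * E' N x)))"
    using Q(3) by (intro low_cmult low_add low_diff low_shift \<open>low d R\<close> low_sum low_mult rat_germ_shift E E') auto
  moreover have "(1 / s ^ d) * (R (x + b) - s ^ Suc d * R x - (\<Sum>M\<in>S. \<kappa> M * E M x) + (\<Sum>N\<in>Q. q N (x + b) * E' N x)) =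
      (\<Sum>M\<in>S. \<kappa> M * D M x) - (\<Sum>N\<in>Q. (q N (x + b) - s * q N x) * H N x)" for x
  proof -
    have 1: "(\<Sum>M\<in>S. \<kappa> M * H M (x + b)) = (\<Sum>M\<in>S. \<kappa> M * E M x) + s ^ Suc d * (\<Sum>M\<in>S. \<kappa> M * H M x) + s ^ d * (\<Sum>M\<in>S. \<kappa> M * D M x)"
      unfolding sum_distrib_left sum.distrib[symmetric] using s_nonzero
      by (intro sum.cong refl) (simp add: E_def field_simps)
    have 2: "(\<Sum>N\<in>Q. q N (x + b) * H N (x + b)) = (\<Sum>N\<in>Q. q N (x + b) * E' N x) + s ^ d * (\<Sum>N\<in>Q. q N (x + b) * H N x)"
      unfolding sum_distrib_left sum.distrib[symmetric]
      by (intro sum.cong refl) (simp add: E'_def field_simps)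
    have 3: "(\<Sum>N\<in>Q. (q N (x + b) - s * q N x) * H N x) = (\<Sum>N\<in>Q. q N (x + b) * H N x) - s * (\<Sum>N\<in>Q. q N x * H N x)"
      unfolding sum_distrib_left sum_subtractf[symmetric]
      by (intro sum.cong refl) (simp add: algebra_simps)
    show ?thesis
      unfolding R_def 1 2 3 using s_nonzero by (simp add: field_simps)
  qed
  ultimately have G: "low d (\<lambda>x. (\<Sum>M\<in>S. \<kappa> M * D M x) - (\<Sum>N\<in>Q. (q N (x + b) - s * q N x) * H N x))"
    by simp
  \<comment> \<open>Regroups the \<open>D M\<close> by the monomial left after removing one factor:
    the pair \<open>(M, i)\<close> contributes \<open>t (M, i)\<close> to the coefficient of
    \<open>g (M, i)\<close>.\<close>
  define P where "P = Sigma S set_mset"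
  define g where "g = (\<lambda>(M, i). M - {#i::nat#})"
  define t where "t = (\<lambda>(M, i) x. \<kappa> M * real (count M i) * r i x)"
  define e where "e N x = (\<Sum>p | p \<in> P \<and> g p = N. t p x)" for N x
  have "finite P"
    using \<open>finite S\<close> by (simp add: P_def)
  have sz: "size (g p) = d" if "p \<in> P" for p
    using that assms(3) by (auto simp: P_def g_def size_Diff_singleton)
  have D_sum: "(\<Sum>M\<in>S. \<kappa> M * D M x) = (\<Sum>N\<in>g ` P. e N x * H N x)" for x
  proof -
    have "(\<Sum>M\<in>S. \<kappa> M * D M x) = (\<Sum>p\<in>P. t p x * H (g p) x)"
      unfolding D_eq_sum P_def sum_distrib_left
      by (subst sum.Sigma) (use \<open>finite S\<close> in \<open>auto simp: t_def g_def mult_ac intro!: sum.cong\<close>)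
    also have "\<dots> = (\<Sum>N\<in>g ` P. \<Sum>p | p \<in> P \<and> g p = N. t p x * H (g p) x)"
      using \<open>finite P\<close> by (rule sum.image_gen)
    also have "\<dots> = (\<Sum>N\<in>g ` P. e N x * H N x)"
      unfolding e_def sum_distrib_right by (intro sum.cong refl) auto
    finally show ?thesis .
  qed
  have e_rat: "rat_germ (e N)" for N
    unfolding e_def[abs_def] by (intro rat_germ_sum) (auto simp: t_def intro!: rat_germ_cmult rat_germ_r)
  have e_out: "e N x = 0" if "N \<notin> g ` P" for N x
  proof -
    have "{p. p \<in> P \<and> g p = N} = {}"
      using that by auto
    then show ?thesis
      unfolding e_def by (simp only: sum.empty)
  qed
  define c where "c N x = e N x - (q N (x + b) - s * q N x)" for N x
  have "(\<Sum>M\<in>S. \<kappa> M * D M x) - (\<Sum>N\<in>Q. (q N (x + b) - s * q N x) * H N x) = (\<Sum>N\<in>Q \<union> g ` P. c N x * H N x)" for x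
  proof -
    have "(\<Sum>N\<in>Q. (q N (x + b) - s * q N x) * H N x) = (\<Sum>N\<in>Q \<union> g ` P. (q N (x + b) - s * q N x) * H N x)"
      using Q \<open>finite P\<close> by (intro sum.mono_neutral_left) auto
    moreover have "(\<Sum>N\<in>g ` P. e N x * H N x) = (\<Sum>N\<in>Q \<union> g ` P. e N x * H N x)"
      using Q \<open>finite P\<close> e_out by (intro sum.mono_neutral_left) auto
    ultimately show ?thesis
      unfolding D_sum c_def by (simp add: left_diff_distrib sum_subtractf)
  qed
  with G have "low d (\<lambda>x. \<Sum>N\<in>Q \<union> g ` P. c N x * H N x)"
    by simp
  moreover have "\<forall>N\<in>Q \<union> g ` P. size N = d \<and> rat_germ (c N)"
    unfolding c_def[abs_def] using Q(2,3) sz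
    by (auto intro!: rat_germ_diff e_rat rat_germ_shift rat_germ_cmult)
  ultimately have zero: "\<forall>N\<in>Q \<union> g ` P. \<forall>\<^sub>F x in at_top. c N x = 0"
    using \<open>finite Q\<close> \<open>finite P\<close> by (intro indepD[OF \<open>indep d\<close>]) auto
  \<comment> \<open>The coefficient to inspect is that of \<open>M0\<close> with one factor removed.
    Only the monomials \<open>add_mset i N0\<close> contribute, each with its own power of
    \<open>1 / x\<close>, so the contribution of \<open>M0\<close> cannot cancel.\<close>
  obtain i0 where i0: "i0 \<in># M0"
    using assms(3,4) by (metis multiset_nonemptyE size_empty nat.distinct(1))
  define N0 where "N0 = M0 - {#i0#}"
  have M0: "M0 = add_mset i0 N0"
    using i0 by (simp add: N0_def)
  define J where "J = {i. add_mset i N0 \<in> S}"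
  define l where "l i = \<kappa> (add_mset i N0) * real (count (add_mset i N0) i) * \<rho> i" for i
  have "inj (\<lambda>i. add_mset i N0)"
    by (simp add: inj_on_def)
  have "finite J"
    unfolding J_def using finite_vimageI[OF \<open>finite S\<close> \<open>inj (\<lambda>i. add_mset i N0)\<close>] by (simp add: vimage_def)
  have "{p \<in> P. g p = N0} = (\<lambda>i. (add_mset i N0, i)) ` J"
    by (force simp: P_def g_def J_def)
  then have "e N0 x = (\<Sum>i\<in>J. l i / x ^ Suc i)" for x
    unfolding e_def
    by (simp only:, subst sum.reindex) (auto simp: inj_on_def t_def l_def r_def)
  moreover have "\<forall>\<^sub>F x in at_top. c N0 x = 0"
    using zero assms(4) i0 by (force simp: P_def g_def N0_def)
  ultimately have "\<forall>\<^sub>F x in at_top. (\<Sum>i\<in>J. l i / x ^ Suc i) = q N0 (x + b) - s * q N0 x"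
    by (simp add: c_def)
  moreover have "i0 \<in> J" "l i0 \<noteq> 0"
    using assms(4,5) \<rho>_nonzero by (auto simp: J_def l_def M0)
  ultimately show False
    using rat_germ_pole_equation_unsolvable b_pos s_nonzero \<open>finite J\<close> Q(3) by blast
qed

text \<open>Induction on the number of terms: after one coefficient is normalised to 1, the
  difference with the shifted relation loses that term. Hence all normalised coefficients are
  \<open>b\<close>-periodic, so constant, and \<open>no_constant_relation\<close> applies.\<close>

lemma indep_Suc:
  assumes "indep d"
  shows "indep (Suc d)"
proof -
  have "\<forall>M\<in>S. \<forall>\<^sub>F x in at_top. c M x = 0"
    if "finite S" "\<forall>M\<in>S. size M = Suc d \<and> rat_germ (c M)" "low (Suc d) (\<lambda>x. \<Sum>M\<in>S. c M x * H M x)" for S c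
    using that
  proof (induction "card S" arbitrary: S c rule: less_induct)
    case less
    show ?case
    proof (rule ccontr)
      assume "\<not> (\<forall>M\<in>S. \<forall>\<^sub>F x in at_top. c M x = 0)"
      then obtain M0 where M0: "M0 \<in> S" "\<not> (\<forall>\<^sub>F x in at_top. c M0 x = 0)"
        by blast
      then have nz: "\<forall>\<^sub>F x in at_top. c M0 x \<noteq> 0"
        using rat_germ_cases less.prems(2) by blast
      define c' where "c' M x = c M x / c M0 x" for M x
      have c'_rat: "rat_germ (c' M)" if "M \<in> S" for M
        unfolding c'_def[abs_def] using that M0(1) less.prems(2) by (intro rat_germ_divide) auto
      define F where "F x = (\<Sum>M\<in>S. c' M x * H M x)" for x
      have "low (Suc d) (\<lambda>x. (1 / c M0 x) * (\<Sum>M\<in>S. c M x * H M x))"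
        using less.prems M0(1) by (intro low_mult rat_germ_divide rat_germ_const) auto
      then have F: "low (Suc d) F"
        by (simp add: F_def[abs_def] c'_def sum_distrib_left)
      define E where "E M x = H M (x + b) - s ^ Suc d * H M x" for M x
      have E: "low (Suc d) (E M)" if "M \<in> S" for M
        using shift_H_leading[of M] less.prems(2) that by (simp add: E_def[abs_def])
      define c'' where "c'' M x = c' M (x + b) - c' M x" for M x
      have c''_rat: "rat_germ (c'' M)" if "M \<in> S" for M
        unfolding c''_def[abs_def] using that by (intro rat_germ_diff rat_germ_shift c'_rat)
      \<comment> \<open>The shift multiplies monomials of degree \<open>Suc d\<close> by
        \<open>s ^ Suc d\<close> up to lower order; this factor is matched before
        subtracting.\<close>
      have "low (Suc d) (\<lambda>x. (1 / s ^ Suc d) * (F (x + b) - s ^ Suc d * F x - (\<Sum>M\<in>S. c' M (x + b) * E M x)))"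
        by (intro low_cmult low_diff low_shift F low_sum low_mult rat_germ_shift E c'_rat)
      moreover have "(1 / s ^ Suc d) * (F (x + b) - s ^ Suc d * F x - (\<Sum>M\<in>S. c' M (x + b) * E M x)) =
          (\<Sum>M\<in>S. c'' M x * H M x)" for x
        unfolding F_def sum_distrib_left sum_subtractf[symmetric] using s_nonzero
        by (intro sum.cong refl) (simp add: E_def c''_def field_simps)
      ultimately have low'': "low (Suc d) (\<lambda>x. \<Sum>M\<in>S. c'' M x * H M x)"
        by simp
      have M0_zero: "\<forall>\<^sub>F x in at_top. c'' M0 x = 0"
        using nz eventually_at_top_shift[OF nz, of b] by eventually_elim (simp add: c''_def c'_def)
      have "low (Suc d) (\<lambda>x. \<Sum>M\<in>S - {M0}. c'' M x * H M x)"
      proof (rule low_cong[OF low''])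
        show "\<forall>\<^sub>F x in at_top. (\<Sum>M\<in>S - {M0}. c'' M x * H M x) = (\<Sum>M\<in>S. c'' M x * H M x)"
          using M0_zero by eventually_elim (simp add: sum.remove[OF less.prems(1) M0(1)])
      qed
      moreover have "card (S - {M0}) < card S"
        using less.prems(1) M0(1) by (rule card_Diff1_less)
      ultimately have "\<forall>M\<in>S - {M0}. \<forall>\<^sub>F x in at_top. c'' M x = 0"
        using less.prems c''_rat by (intro less.hyps) auto
      with M0_zero have zero: "\<forall>\<^sub>F x in at_top. c' M (x + b) = c' M x" if "M \<in> S" for M
        using that by (cases "M = M0") (auto simp: c''_def)
      have "\<exists>a. \<forall>\<^sub>F x in at_top. c' M x = a" if "M \<in> S" for M
        using rat_germ_periodic_const[OF c'_rat b_pos zero] that by blast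
      then obtain \<kappa> where \<kappa>: "\<And>M. M \<in> S \<Longrightarrow> \<forall>\<^sub>F x in at_top. c' M x = \<kappa> M"
        by metis
      have "\<kappa> M0 = 1"
      proof -
        have "\<forall>\<^sub>F x in at_top. c M0 x \<noteq> 0 \<and> c' M0 x = \<kappa> M0"
          using nz \<kappa>[OF M0(1)] by (rule eventually_conj)
        then have "\<exists>x. c M0 x \<noteq> 0 \<and> c' M0 x = \<kappa> M0"
          by (rule eventually_happens'[rotated]) simp
        then show ?thesis
          by (auto simp: c'_def)
      qed
      have "\<forall>\<^sub>F x in at_top. \<forall>M\<in>S. c' M x = \<kappa> M"
        using \<kappa> less.prems(1) by (simp add: eventually_ball_finite_distrib)
      then have "\<forall>\<^sub>F x in at_top. (\<Sum>M\<in>S. \<kappa> M * H M x) = F x"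
        by eventually_elim (simp add: F_def)
      then have "low (Suc d) (\<lambda>x. \<Sum>M\<in>S. \<kappa> M * H M x)"
        by (rule low_cong[OF F])
      then show False
        using no_constant_relation[OF assms less.prems(1) _ M0(1), of \<kappa>] less.prems(2) \<open>\<kappa> M0 = 1\<close> by simp
    qed
  qed
  then show ?thesis
    unfolding indep_def by blast
qed

lemma indep: "indep d"
  by (induction d) (auto intro: indep_0 indep_Suc)

text \<open>An inhomogeneous relation is peeled from the top: its part of highest degree equals an
  expression of lower degree, so those coefficients vanish and the remaining degrees form a relation
  again.\<close>

lemma monomials_independent:
  assumes "finite S" "\<And>M. M \<in> S \<Longrightarrow> rat_germ (c M)"
    and "\<forall>\<^sub>F x in at_top. (\<Sum>M\<in>S. c M x * (\<Prod>i\<in>#M. h i x)) = 0" "M \<in> S"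
  shows "\<forall>\<^sub>F x in at_top. c M x = 0"
proof -
  have "\<forall>M\<in>S. \<forall>\<^sub>F x in at_top. c M x = 0"
    if "\<forall>M\<in>S. size M < d" "finite S" "\<forall>M\<in>S. rat_germ (c M)"
      "\<forall>\<^sub>F x in at_top. (\<Sum>M\<in>S. c M x * H M x) = 0" for d S
    using that
  proof (induction d arbitrary: S)
    case 0
    then show ?case by auto
  next
    case (Suc d)
    define A where "A = {M \<in> S. size M = d}"
    define B where "B = {M \<in> S. size M < d}"
    have "(\<Sum>M\<in>S. c M x * H M x) = (\<Sum>M\<in>A. c M x * H M x) + (\<Sum>M\<in>B. c M x * H M x)" for x
      using Suc.prems(1,2)
      by (subst sum.union_disjoint[symmetric]) (auto simp: A_def B_def intro!: sum.cong)
    with Suc.prems(4) have ev: "\<forall>\<^sub>F x in at_top. (\<Sum>M\<in>A. c M x * H M x) + (\<Sum>M\<in>B. c M x * H M x) = 0"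
      by simp
    have "low d (\<lambda>x. (- 1) * (\<Sum>M\<in>B. c M x * H M x))"
      using Suc.prems(3) by (intro low_cmult low_sum low_monomial) (auto simp: B_def)
    then have "low d (\<lambda>x. \<Sum>M\<in>A. c M x * H M x)"
      by (rule low_cong) (use ev in eventually_elim, simp)
    then have zA: "\<forall>M\<in>A. \<forall>\<^sub>F x in at_top. c M x = 0"
      using Suc.prems(2,3) by (intro indepD[OF indep[of d]]) (auto simp: A_def)
    then have "\<forall>\<^sub>F x in at_top. \<forall>M\<in>A. c M x = 0"
      using Suc.prems(2) by (intro eventually_ball_finite) (simp_all add: A_def)
    with ev have "\<forall>\<^sub>F x in at_top. (\<Sum>M\<in>B. c M x * H M x) = 0"
      by eventually_elim simp
    then have zB: "\<forall>M\<in>B. \<forall>\<^sub>F x in at_top. c M x = 0"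
      using Suc.prems(2,3) by (intro Suc.IH) (auto simp: B_def)
    show ?case
      using zA zB Suc.prems(1) less_Suc_eq by (auto simp: A_def B_def)
  qed
  from this[of S "Suc (Max (size ` S))"] show ?thesis
    using assms by (auto simp: H_def less_Suc_eq_le)
qed

end

subsection \<open>The Laplace-type integral and its derivatives\<close>

text \<open>The arguments \<open>b\<close> and \<open>x\<close> stand for \<open>\<xi> 0\<close> and
  \<open>\<xi> 1\<close>; the factor \<open>(- t) ^ k\<close> arises from \<open>k\<close>
  derivatives in \<open>x\<close>.\<close>

definition laplace_kernel :: "nat \<Rightarrow> real \<Rightarrow> real \<Rightarrow> real \<Rightarrow> real" where
  "laplace_kernel k b x t = (- t) ^ k * exp (- (x * t)) * (b / (2 + exp (- (b * t))))"

definition laplace_deriv :: "nat \<Rightarrow> real \<Rightarrow> real \<Rightarrow> real" where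
  "laplace_deriv k b x = integral {0..1} (laplace_kernel k b x)"

definition monomial_laplace :: "nat \<Rightarrow> real \<Rightarrow> real" where
  "monomial_laplace k x = integral {0..1} (\<lambda>t. (- t) ^ k * exp (- (x * t)))"

lemma two_plus_exp_pos: "2 + exp (y::real) > 0" "2 + exp y \<noteq> 0"
  using exp_gt_zero[of y] by linarith+

lemma continuous_on_laplace_kernel: "continuous_on S (laplace_kernel k b x)"
  unfolding laplace_kernel_def[abs_def] by (intro continuous_intros ballI two_plus_exp_pos)

lemma laplace_kernel_integrable: "laplace_kernel k b x integrable_on {a..c}"
  by (intro integrable_continuous_real continuous_on_laplace_kernel)

text \<open>Differentiation under the integral sign; the derivative of the kernel in
  \<open>x\<close> only adds a factor \<open>- t\<close>.\<close>

lemma laplace_deriv_has_derivative: "(laplace_deriv k b has_field_derivative laplace_deriv (Suc k) b x) (at x)"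
proof -
  have "((\<lambda>x. integral (cbox 0 1) (laplace_kernel k b x)) has_field_derivative
      integral (cbox 0 1) (laplace_kernel (Suc k) b x)) (at x within UNIV)"
  proof (rule leibniz_rule_field_derivative[of UNIV])
    show "((\<lambda>x. laplace_kernel k b x t) has_field_derivative laplace_kernel (Suc k) b x t) (at x within UNIV)" for x t
    proof -
      have "((\<lambda>x. A * exp (- (x * t)) * B) has_field_derivative (- t) * A * exp (- (x * t)) * B) (at x)" for A B
        by (auto intro!: derivative_eq_intros)
      from this[of "(- t) ^ k" "b / (2 + exp (- (b * t)))"] show ?thesis
        unfolding laplace_kernel_def by (simp only: power_Suc)
    qed
    show "continuous_on (UNIV \<times> cbox 0 1) (\<lambda>(x, t). laplace_kernel (Suc k) b x t)"
      unfolding laplace_kernel_def split_beta by (intro continuous_intros ballI two_plus_exp_pos)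
  qed (auto simp: laplace_kernel_integrable cbox_interval)
  then show ?thesis
    by (simp add: laplace_deriv_def[abs_def] cbox_interval)
qed

lemma laplace_deriv_bounded:
  assumes "x \<ge> 0" "b > 0"
  shows "\<bar>laplace_deriv k b x\<bar> \<le> b"
proof -
  have "norm (laplace_kernel k b x t) \<le> b" if "t \<in> {0..1}" for t
  proof -
    have "\<bar>(- t) ^ k\<bar> \<le> 1"
      using that by (simp add: power_abs power_le_one)
    moreover have "exp (- (x * t)) \<le> 1"
      using that assms by simp
    moreover have "b / (2 + exp (- (b * t))) \<le> b / 1"
      using assms two_plus_exp_pos[of "- (b * t)"] by (intro divide_left_mono) auto
    moreover have "0 \<le> b / (2 + exp (- (b * t)))"
      using assms by (intro divide_nonneg_pos two_plus_exp_pos) auto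
    ultimately have "\<bar>(- t) ^ k\<bar> * exp (- (x * t)) * (b / (2 + exp (- (b * t)))) \<le> 1 * 1 * b"
      by (intro mult_mono) auto
    moreover have "norm (laplace_kernel k b x t) = \<bar>(- t) ^ k\<bar> * exp (- (x * t)) * (b / (2 + exp (- (b * t))))"
      unfolding laplace_kernel_def real_norm_def abs_mult
      using \<open>0 \<le> b / (2 + exp (- (b * t)))\<close> by (simp only: abs_of_nonneg exp_ge_zero)
    ultimately show ?thesis by simp
  qed
  then have "norm (integral (cbox 0 1) (laplace_kernel k b x)) \<le> b * measure lborel (cbox 0 (1::real))"
    using assms by (intro integrable_bound) (auto simp: laplace_kernel_integrable cbox_interval)
  then show ?thesis
    by (simp add: laplace_deriv_def cbox_interval)
qed

text \<open>Shifting \<open>x\<close> by \<open>b\<close> multiplies the kernel by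
  \<open>exp (- (b * t))\<close>, so adding twice the kernel cancels its denominator.\<close>

lemma laplace_deriv_shift: "laplace_deriv k b (x + b) + 2 * laplace_deriv k b x = b * monomial_laplace k x"
proof -
  have "laplace_kernel k b (x + b) t + 2 * laplace_kernel k b x t = b * ((- t) ^ k * exp (- (x * t)))" for t
  proof -
    have e: "exp (- ((x + b) * t)) = exp (- (x * t)) * exp (- (b * t))"
      by (simp add: exp_add[symmetric] algebra_simps)
    have "laplace_kernel k b (x + b) t + 2 * laplace_kernel k b x t =
        (- t) ^ k * exp (- (x * t)) * (2 + exp (- (b * t))) * (b / (2 + exp (- (b * t))))"
      unfolding laplace_kernel_def e by (simp only: algebra_simps)
    then show ?thesis
      using two_plus_exp_pos(2)[of "- (b * t)"] by simp
  qed
  then have "integral {0..1} (\<lambda>t. laplace_kernel k b (x + b) t + 2 * laplace_kernel k b x t) = b * monomial_laplace k x"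
    unfolding monomial_laplace_def by simp
  moreover have "integral {0..1} (\<lambda>t. laplace_kernel k b (x + b) t + 2 * laplace_kernel k b x t) = laplace_deriv k b (x + b) + 2 * laplace_deriv k b x"
    unfolding laplace_deriv_def by (subst integral_add) (auto intro!: integrable_on_mult_right laplace_kernel_integrable)
  ultimately show ?thesis by simp
qed

section \<open>Asymptotics of the truncated Laplace transform of a monomial\<close>

lemma monomial_laplace_0:
  assumes "x \<noteq> 0"
  shows "monomial_laplace 0 x = 1 / x - exp (- x) / x"
proof -
  define G where "G t = - exp (- (x * t)) / x" for t
  have "((\<lambda>t. exp (- (x * t))) has_integral (G 1 - G 0)) {0..1}"
  proof (rule fundamental_theorem_of_calculus)
    show "(G has_vector_derivative exp (- (x * t))) (at t within {0..1})" for t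
      unfolding has_real_derivative_iff_has_vector_derivative[symmetric] G_def[abs_def]
      using assms by (auto intro!: derivative_eq_intros)
  qed simp
  then show ?thesis
    unfolding monomial_laplace_def by (simp add: integral_unique G_def)
qed

text \<open>Integration by parts: \<open>G\<close> is the boundary term, and its value at 1 leaves
  the summand with \<open>exp (- x)\<close>.\<close>

lemma monomial_laplace_Suc:
  assumes "x \<noteq> 0"
  shows "monomial_laplace (Suc k) x = - (real (Suc k) / x) * monomial_laplace k x - (- 1) ^ Suc k * exp (- x) / x"
proof -
  define G where "G t = - ((- t) ^ Suc k * exp (- (x * t)) / x)" for t :: real
  have "((\<lambda>t. (- t) ^ Suc k * exp (- (x * t)) + (real (Suc k) / x) * ((- t) ^ k * exp (- (x * t))))
      has_integral (G 1 - G 0)) {0..1}"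
  proof (rule fundamental_theorem_of_calculus)
    show "(G has_vector_derivative (- t) ^ Suc k * exp (- (x * t)) + (real (Suc k) / x) * ((- t) ^ k * exp (- (x * t))))
        (at t within {0..1})" for t
      unfolding has_real_derivative_iff_has_vector_derivative[symmetric] G_def[abs_def]
      using assms by (auto intro!: derivative_eq_intros simp del: power_Suc) (simp add: field_simps)
  qed simp
  then have "integral {0..1} (\<lambda>t. (- t) ^ Suc k * exp (- (x * t)) + (real (Suc k) / x) * ((- t) ^ k * exp (- (x * t)))) = G 1 - G 0"
    by (rule integral_unique)
  moreover have "integral {0..1} (\<lambda>t. (- t) ^ Suc k * exp (- (x * t)) + (real (Suc k) / x) * ((- t) ^ k * exp (- (x * t)))) =
      monomial_laplace (Suc k) x + (real (Suc k) / x) * monomial_laplace k x"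
    unfolding monomial_laplace_def
    by (subst integral_add)
      (auto intro!: integrable_continuous_real continuous_intros simp: assms simp del: power_Suc)
  ultimately show ?thesis
    by (simp add: G_def)
qed

lemma rapid_decay_exp: "rapid_decay (\<lambda>x. exp (- x))"
  unfolding rapid_decay_def
proof
  fix k
  show "((\<lambda>x::real. x ^ k * exp (- x)) \<longlongrightarrow> 0) at_top"
    using tendsto_power_div_exp_0[of k] by (simp only: exp_minus divide_inverse)
qed

text \<open>The recursion multiplies the main term by \<open>- (k + 1) / x\<close>, which builds up
  the alternating factorials, while every boundary term carries \<open>exp (- x)\<close>. Writing
  \<open>x\<close> as \<open>poly [:0, 1:] x\<close> fits the rules for rational germs.\<close>

lemma monomial_laplace_asymp:
  "rapid_decay (\<lambda>x. monomial_laplace k x - (- 1) ^ k * fact k / x ^ Suc k)"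
proof (induction k)
  case 0
  have "rapid_decay (\<lambda>x. (- 1 / poly [:0, 1:] x) * exp (- x))"
    by (intro rapid_decay_rat_germ_mult rapid_decay_exp rat_germ_divide rat_germ_const rat_germ_poly)
  then show ?case
    by (rule rapid_decay_cong) (use eventually_gt_at_top[of 0] in eventually_elim, simp add: monomial_laplace_0)
next
  case (Suc k)
  have "rapid_decay (\<lambda>x. (- real (Suc k) / poly [:0, 1:] x) * (monomial_laplace k x - (- 1) ^ k * fact k / x ^ Suc k))"
    by (intro rapid_decay_rat_germ_mult Suc rat_germ_divide rat_germ_const rat_germ_poly)
  moreover have "rapid_decay (\<lambda>x. (- ((- 1) ^ Suc k) / poly [:0, 1:] x) * exp (- x))"
    by (intro rapid_decay_rat_germ_mult rapid_decay_exp rat_germ_divide rat_germ_const rat_germ_poly)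
  ultimately have "rapid_decay (\<lambda>x. (- real (Suc k) / poly [:0, 1:] x) * (monomial_laplace k x - (- 1) ^ k * fact k / x ^ Suc k) +
      (- ((- 1) ^ Suc k) / poly [:0, 1:] x) * exp (- x))"
    by (rule rapid_decay_add)
  then show ?case
    by (rule rapid_decay_cong)
      (use eventually_gt_at_top[of 0] in eventually_elim, simp add: monomial_laplace_Suc field_simps)
qed

lemma shift_system_laplace_deriv:
  assumes "b > 0"
  shows "shift_system (\<lambda>k. laplace_deriv k b) (\<lambda>k. b * ((- 1) ^ k * fact k)) b (- 2)"
proof
  fix k
  show "\<exists>C. \<forall>\<^sub>F x in at_top. \<bar>laplace_deriv k b x\<bar> \<le> C"
    using laplace_deriv_bounded[OF _ assms] eventually_ge_at_top[of 0]
    by (intro exI[of _ b] eventually_mono[OF eventually_ge_at_top[of 0]]) auto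
  have "rapid_decay (\<lambda>x. b * (monomial_laplace k x - (- 1) ^ k * fact k / x ^ Suc k))"
    by (intro rapid_decay_rat_germ_mult rat_germ_const monomial_laplace_asymp)
  then show "rapid_decay (\<lambda>x. laplace_deriv k b (x + b) - (b * ((- 1) ^ k * fact k) / x ^ Suc k + - 2 * laplace_deriv k b x))"
  proof (rule rapid_decay_cong)
    show "\<forall>\<^sub>F x in at_top. laplace_deriv k b (x + b) - (b * ((- 1) ^ k * fact k) / x ^ Suc k + - 2 * laplace_deriv k b x) =
        b * (monomial_laplace k x - (- 1) ^ k * fact k / x ^ Suc k)"
      using laplace_deriv_shift[of k b] by (auto simp: algebra_simps simp del: power_Suc)
  qed
qed (use assms in auto)

subsection \<open>Transcendental transcendence\<close>

definition phi :: "(nat \<Rightarrow> real) \<Rightarrow> real" where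
  "phi \<xi> = laplace_deriv 0 (\<xi> 0) (\<xi> 1)"

text \<open>Coordinates from 2 on vanish because points of the plane are sequences. Positivity of
  \<open>\<xi> 0\<close> lets it serve as the length of the shift.\<close>

definition half_plane :: "(nat \<Rightarrow> real) set" where
  "half_plane = {\<xi>. \<xi> 0 > 0 \<and> (\<forall>i\<ge>2. \<xi> i = 0)}"

lemma openin_half_plane: "openin (Euclidean_space 2) half_plane"
proof -
  have "openin (powertop_real UNIV) {\<xi> \<in> topspace (powertop_real UNIV). \<xi> 0 \<in> {0<..}}"
    by (rule openin_continuous_map_preimage[OF continuous_map_product_coordinates]) auto
  then show ?thesis
    unfolding Euclidean_space_def half_plane_def openin_subtopology
    by (intro exI[of _ "{\<xi>. \<xi> 0 \<in> {0<..}}"]) auto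
qed

text \<open>As an equation between functions it can be differentiated again in the
  induction.\<close>

lemma partial_derivs_phi: "(partial_deriv 1 ^^ k) phi = (\<lambda>\<xi>. laplace_deriv k (\<xi> 0) (\<xi> 1))"
proof (induction k)
  case 0
  show ?case by (simp add: phi_def[abs_def])
next
  case (Suc k)
  have "deriv (laplace_deriv k b) x = laplace_deriv (Suc k) b x" for b x
    using laplace_deriv_has_derivative by (rule DERIV_imp_deriv)
  then show ?case
    using Suc by (simp add: partial_deriv_def[abs_def])
qed

section \<open>Sorting a differential polynomial by its jet monomials\<close>

lemma monom_eval_superset:
  assumes "finite T" "Poly_Mapping.keys \<alpha> \<subseteq> T"
  shows "monom_eval \<alpha> v = (\<Prod>i\<in>T. v i ^ Poly_Mapping.lookup \<alpha> i)"
  unfolding monom_eval_def using assms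
  by (intro prod.mono_neutral_left) (auto simp: in_keys_iff)

text \<open>Keeps the exponents of the variables \<open>Y_k\<close>, \<open>k \<le> n\<close>, in
  the multiset form of \<open>shift_system\<close>. Monomials differing only in the
  \<open>\<xi>\<close> exponents fall together, since jointly they form one coefficient.\<close>

definition jet_mset :: "nat \<Rightarrow> (nat + nat) monom \<Rightarrow> nat multiset" where
  "jet_mset n \<alpha> = (\<Sum>k\<le>n. replicate_mset (Poly_Mapping.lookup \<alpha> (Inr k)) k)"

lemma count_jet_mset: "k \<le> n \<Longrightarrow> count (jet_mset n \<alpha>) k = Poly_Mapping.lookup \<alpha> (Inr k)"
  by (simp add: jet_mset_def count_sum)

lemma prod_jet_mset:
  "(\<Prod>i\<in>#jet_mset n \<alpha>. f i) = (\<Prod>k\<le>n. (f k :: real) ^ Poly_Mapping.lookup \<alpha> (Inr k))"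
  unfolding jet_mset_def by (induction n) auto

lemma monom_eval_case_sum:
  assumes "Poly_Mapping.keys \<alpha> \<subseteq> Inl ` {..<2} \<union> Inr ` {..n}"
  shows "monom_eval \<alpha> (case_sum \<xi> f) =
    \<xi> 0 ^ Poly_Mapping.lookup \<alpha> (Inl 0) * \<xi> 1 ^ Poly_Mapping.lookup \<alpha> (Inl 1) * (\<Prod>i\<in>#jet_mset n \<alpha>. f i)"
proof -
  have "monom_eval \<alpha> (case_sum \<xi> f) =
      (\<Prod>i\<in>Inl ` {..<2} \<union> Inr ` {..n}. case_sum \<xi> f i ^ Poly_Mapping.lookup \<alpha> i)"
    using assms by (intro monom_eval_superset) auto
  also have "\<dots> = (\<Prod>i\<in>Inl ` {..<2}. case_sum \<xi> f i ^ Poly_Mapping.lookup \<alpha> i) *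
      (\<Prod>i\<in>Inr ` {..n}. case_sum \<xi> f i ^ Poly_Mapping.lookup \<alpha> i)"
    by (intro prod.union_disjoint) auto
  also have "\<dots> = (\<Prod>i<2. \<xi> i ^ Poly_Mapping.lookup \<alpha> (Inl i)) * (\<Prod>k\<le>n. f k ^ Poly_Mapping.lookup \<alpha> (Inr k))"
    by (simp add: prod.reindex)
  finally show ?thesis
    by (simp add: prod_jet_mset numeral_2_eq_2)
qed

text \<open>The relation in direction 1 is refuted. For fixed \<open>b > 0\<close> it relates
  monomials in the \<open>laplace_deriv k b\<close> with coefficients polynomial in
  \<open>x\<close>, so these all vanish; letting \<open>b\<close> vary kills the coefficients of
  \<open>p\<close>.\<close>

lemma not_DA_phi: "\<not> DA_on 2 phi half_plane"
proof
  assume "DA_on 2 phi half_plane"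
  then obtain n p where p: "p \<noteq> 0" "mpoly_vars p \<subseteq> Inl ` {..<2} \<union> Inr ` {..n}"
    "\<forall>\<xi>\<in>half_plane. mpoly_eval p (case_sum \<xi> (\<lambda>k. (partial_deriv 1 ^^ k) phi \<xi>)) = 0"
    unfolding DA_on_def by (metis one_less_numeral_iff semiring_norm(76))
  let ?K = "Poly_Mapping.keys p" and ?c = "Poly_Mapping.lookup p"
  let ?e0 = "\<lambda>\<alpha>. Poly_Mapping.lookup \<alpha> (Inl 0)" and ?e1 = "\<lambda>\<alpha>. Poly_Mapping.lookup \<alpha> (Inl 1)"
  have keys: "Poly_Mapping.keys \<alpha> \<subseteq> Inl ` {..<2} \<union> Inr ` {..n}" if "\<alpha> \<in> ?K" for \<alpha>
    using p(2) that unfolding mpoly_vars_def by blast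
  obtain \<beta> where \<beta>: "\<beta> \<in> ?K"
    using p(1) by (metis ex_in_conv keys_eq_empty)
  define S where "S = jet_mset n ` ?K"
  \<comment> \<open>\<open>C b M\<close> collects, as a polynomial in \<open>x\<close>, all terms
    with jet monomial \<open>M\<close> after \<open>b\<close> is substituted for
    \<open>\<xi> 0\<close>.\<close>
  define C where "C b M = (\<Sum>\<alpha> | \<alpha> \<in> ?K \<and> jet_mset n \<alpha> = M. monom (?c \<alpha> * b ^ ?e0 \<alpha>) (?e1 \<alpha>))" for b M
  have C_zero: "C b M = 0" if "b > 0" "M \<in> S" for b M
  proof -
    interpret shift_system "\<lambda>k. laplace_deriv k b" "\<lambda>k. b * ((- 1) ^ k * fact k)" b "- 2"
      using \<open>b > 0\<close> by (rule shift_system_laplace_deriv)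
    have eval: "(\<Sum>M\<in>S. poly (C b M) x * (\<Prod>i\<in>#M. laplace_deriv i b x)) = 0" for x
    proof -
      define \<xi> where "\<xi> = (\<lambda>_::nat. 0)(0 := b, 1 := x :: real)"
      have \<xi>: "\<xi> \<in> half_plane" "\<xi> 0 = b" "\<xi> 1 = x"
        using \<open>b > 0\<close> by (auto simp: \<xi>_def half_plane_def)
      have "0 = mpoly_eval p (case_sum \<xi> (\<lambda>k. laplace_deriv k b x))"
        using bspec[OF p(3) \<xi>(1), unfolded partial_derivs_phi \<xi>(2,3)] by (rule sym)
      also have "\<dots> = (\<Sum>\<alpha>\<in>?K. ?c \<alpha> * (b ^ ?e0 \<alpha> * x ^ ?e1 \<alpha> * (\<Prod>i\<in>#jet_mset n \<alpha>. laplace_deriv i b x)))"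
        unfolding mpoly_eval_def by (intro sum.cong refl) (simp add: monom_eval_case_sum[OF keys] \<xi> del: One_nat_def)
      also have "\<dots> = (\<Sum>M\<in>S. \<Sum>\<alpha> | \<alpha> \<in> ?K \<and> jet_mset n \<alpha> = M.
          ?c \<alpha> * (b ^ ?e0 \<alpha> * x ^ ?e1 \<alpha> * (\<Prod>i\<in>#jet_mset n \<alpha>. laplace_deriv i b x)))"
        unfolding S_def by (rule sum.image_gen) simp
      also have "\<dots> = (\<Sum>M\<in>S. poly (C b M) x * (\<Prod>i\<in>#M. laplace_deriv i b x))"
        unfolding C_def poly_sum poly_monom sum_distrib_right
        by (intro sum.cong refl) (auto simp: mult_ac)
      finally show ?thesis ..
    qed
    have "\<forall>\<^sub>F x in at_top. poly (C b M) x = 0"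
      by (rule monomials_independent[of S "\<lambda>M. poly (C b M)"])
        (use that eval in \<open>auto simp: S_def intro: rat_germ_poly\<close>)
    then show ?thesis
      by (rule poly_eq_0_if_eventually)
  qed
  \<comment> \<open>The terms that share the jet monomial and the \<open>\<xi> 1\<close> exponent of
    \<open>\<beta>\<close>: together they form one polynomial in \<open>b\<close>, which vanishes
    for all \<open>b > 0\<close>.\<close>
  define A where "A = {\<alpha> \<in> ?K. jet_mset n \<alpha> = jet_mset n \<beta> \<and> ?e1 \<alpha> = ?e1 \<beta>}"
  have "finite A"
    by (simp add: A_def)
  have "poly (\<Sum>\<alpha>\<in>A. monom (?c \<alpha>) (?e0 \<alpha>)) b = 0" if "b > 0" for b
  proof -
    have "coeff (C b (jet_mset n \<beta>)) (?e1 \<beta>) =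
        (\<Sum>\<alpha> | \<alpha> \<in> ?K \<and> jet_mset n \<alpha> = jet_mset n \<beta>. if ?e1 \<alpha> = ?e1 \<beta> then ?c \<alpha> * b ^ ?e0 \<alpha> else 0)"
      by (simp add: C_def coeff_sum)
    also have "\<dots> = (\<Sum>\<alpha>\<in>A. ?c \<alpha> * b ^ ?e0 \<alpha>)"
      by (intro sum.mono_neutral_cong_right) (auto simp: A_def)
    finally show ?thesis
      using C_zero[OF that, of "jet_mset n \<beta>"] \<beta> by (simp add: S_def poly_sum poly_monom)
  qed
  then have "(\<Sum>\<alpha>\<in>A. monom (?c \<alpha>) (?e0 \<alpha>)) = 0"
    by (intro poly_eq_0_if_eventually eventually_mono[OF eventually_gt_at_top[of 0]])
  then have "0 = coeff (\<Sum>\<alpha>\<in>A. monom (?c \<alpha>) (?e0 \<alpha>)) (?e0 \<beta>)"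
    by simp
  also have "\<dots> = (\<Sum>\<alpha>\<in>A. if ?e0 \<alpha> = ?e0 \<beta> then ?c \<alpha> else 0)"
    by (simp add: coeff_sum)
  \<comment> \<open>The jet monomial and the two \<open>\<xi>\<close> exponents determine a
    monomial, so only \<open>\<beta>\<close> is left.\<close>
  also have "\<dots> = (\<Sum>\<alpha>\<in>{\<beta>}. ?c \<alpha>)"
  proof (intro sum.mono_neutral_cong_right \<open>finite A\<close> ballI)
    fix \<alpha> assume \<alpha>: "\<alpha> \<in> A - {\<beta>}"
    have "?e0 \<alpha> \<noteq> ?e0 \<beta>"
    proof
      assume e0: "?e0 \<alpha> = ?e0 \<beta>"
      have "Poly_Mapping.lookup \<alpha> i = Poly_Mapping.lookup \<beta> i" for i
      proof (cases "i \<in> Inl ` {..<2} \<union> Inr ` {..n}")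
        case True
        then consider "i = Inl 0" | "i = Inl 1" | k where "k \<le> n" "i = Inr k"
          by (auto simp: less_2_cases_iff)
        then show ?thesis
          using e0 \<alpha> count_jet_mset[of _ n \<alpha>] count_jet_mset[of _ n \<beta>] by cases (auto simp: A_def)
      next
        case False
        then show ?thesis
          using keys[of \<alpha>] keys[OF \<beta>] \<alpha> by (metis (no_types, lifting) A_def DiffD1 in_keys_iff mem_Collect_eq subsetD)
      qed
      then have "\<alpha> = \<beta>"
        by (rule poly_mapping_eqI)
      then show False
        using \<alpha> by simp
    qed
    then show "(if ?e0 \<alpha> = ?e0 \<beta> then ?c \<alpha> else 0) = 0"
      by simp
  qed (use \<beta> in \<open>auto simp: A_def\<close>)
  finally show False
    using \<beta> by (simp add: in_keys_iff)
qed

subsection \<open>Analyticity\<close>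

text \<open>The majorant gives uniform convergence along the filter of finite index sets by the
  Weierstrass test, and uniform limits commute with the integral.\<close>

lemma has_sum_integral_interchange:
  fixes f :: "'a \<Rightarrow> real \<Rightarrow> real"
  assumes cont: "\<And>i. i \<in> I \<Longrightarrow> continuous_on {0..1} (f i)"
    and bound: "\<And>i t. i \<in> I \<Longrightarrow> t \<in> {0..1} \<Longrightarrow> \<bar>f i t\<bar> \<le> B i"
    and B: "B summable_on I"
    and sum: "\<And>t. t \<in> {0..1} \<Longrightarrow> ((\<lambda>i. f i t) has_sum F t) I"
  shows "((\<lambda>i. integral {0..1} (f i)) has_sum integral {0..1} F) I"
proof -
  \<comment> \<open>Extension by zero outside \<open>I\<close> makes the partial sum over every set
    \<open>X\<close> continuous.\<close>
  define g where "g i = (if i \<in> I then f i else (\<lambda>_. 0))" for i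
  have "uniform_limit {0..1} (\<lambda>X t. \<Sum>i\<in>X. g i t) F (finite_subsets_at_top I)"
  proof (rule Weierstrass_m_test_general'[OF _ _ B])
    show "((\<lambda>i. g i t) has_sum F t) I" if "t \<in> {0..1}" for t
      using sum[OF that] by (rule has_sum_cong[THEN iffD1, rotated]) (simp add: g_def)
  qed (use bound in \<open>auto simp: g_def\<close>)
  moreover have "continuous_on {0..1} (\<lambda>t. \<Sum>i\<in>X. g i t)" for X
    by (intro continuous_on_sum) (auto simp: g_def cont)
  moreover have "finite_subsets_at_top I \<noteq> bot"
    by simp
  ultimately obtain J K where
    J: "\<And>X. ((\<lambda>t. \<Sum>i\<in>X. g i t) has_integral J X) {0..1}"
    and K: "(F has_integral K) {0..1}" "(J \<longlongrightarrow> K) (finite_subsets_at_top I)"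
    by (rule uniform_limit_integral[where F = "finite_subsets_at_top I"]) blast
  have "J X = (\<Sum>i\<in>X. integral {0..1} (f i))" if "finite X" "X \<subseteq> I" for X
  proof -
    have "J X = integral {0..1} (\<lambda>t. \<Sum>i\<in>X. g i t)"
      using J by (rule integral_unique[symmetric])
    also have "\<dots> = (\<Sum>i\<in>X. integral {0..1} (g i))"
      using that by (intro integral_sum integrable_continuous_real) (auto simp: g_def cont)
    also have "\<dots> = (\<Sum>i\<in>X. integral {0..1} (f i))"
      using that by (intro sum.cong refl) (auto simp: g_def)
    finally show ?thesis .
  qed
  then have "\<forall>\<^sub>F X in finite_subsets_at_top I. J X = (\<Sum>i\<in>X. integral {0..1} (f i))"
    by (auto intro: eventually_finite_subsets_at_top_weakI)
  with K(2) have "((\<lambda>X. \<Sum>i\<in>X. integral {0..1} (f i)) \<longlongrightarrow> K) (finite_subsets_at_top I)"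
    by (rule Lim_transform_eventually)
  then show ?thesis
    using K(1) by (simp add: has_sum_def integral_unique)
qed

text \<open>For real series unconditional and absolute convergence coincide, so the double series is
  absolutely summable and may be summed row by row.\<close>

lemma has_sum_Times:
  fixes f :: "'a \<Rightarrow> real" and g :: "'b \<Rightarrow> real"
  assumes f: "(f has_sum a) A" and g: "(g has_sum b) B"
  shows "((\<lambda>(x, y). f x * g y) has_sum a * b) (A \<times> B)"
proof (rule has_sum_SigmaI)
  show "((\<lambda>y. case (x, y) of (x, y) \<Rightarrow> f x * g y) has_sum f x * b) B" for x
    using has_sum_cmult_right[OF g, of "f x"] by simp
  show "((\<lambda>x. f x * b) has_sum a * b) A"
    by (rule has_sum_cmult_left[OF f])
  have fabs: "(\<lambda>x. \<bar>f x\<bar>) summable_on A" and gabs: "(\<lambda>y. \<bar>g y\<bar>) summable_on B"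
    using f g summable_on_iff_abs_summable_on_real[of f A] summable_on_iff_abs_summable_on_real[of g B]
    by (auto dest: has_sum_imp_summable)
  have "(\<lambda>(x, y). \<bar>f x\<bar> * \<bar>g y\<bar>) summable_on A \<times> B"
  proof (rule summable_on_SigmaI)
    show "((\<lambda>y. case (x, y) of (x, y) \<Rightarrow> \<bar>f x\<bar> * \<bar>g y\<bar>) has_sum \<bar>f x\<bar> * infsum (\<lambda>y. \<bar>g y\<bar>) B) B" for x
      using has_sum_cmult_right[OF has_sum_infsum[OF gabs], of "\<bar>f x\<bar>"] by simp
    show "(\<lambda>x. \<bar>f x\<bar> * infsum (\<lambda>y. \<bar>g y\<bar>) B) summable_on A"
      using fabs by (rule summable_on_cmult_left)
  qed auto
  then show "(\<lambda>(x, y). f x * g y) summable_on A \<times> B"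
    by (subst summable_on_iff_abs_summable_on_real) (simp add: case_prod_unfold abs_mult)
qed

lemma has_sum_exp: "((\<lambda>k. x ^ k / fact k) has_sum exp x) UNIV"
  for x :: real
proof (rule norm_summable_imp_has_sum)
  show "summable (\<lambda>k. norm (x ^ k / fact k))"
    using summable_norm_exp[of x] by (simp add: divide_inverse mult_ac)
  show "(\<lambda>k. x ^ k / fact k) sums exp x"
    using exp_converges[of x] by (simp add: divide_inverse mult_ac)
qed

lemma has_sum_geometric:
  fixes x :: real
  assumes "\<bar>x\<bar> < 1"
  shows "((\<lambda>m. x ^ m) has_sum 1 / (1 - x)) UNIV"
  using assms by (intro norm_summable_imp_has_sum geometric_sums) (auto simp: power_abs summable_geometric)

text \<open>Collects equal monomials of a redundantly indexed series. Absolute convergence at radius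
  \<open>r\<close> makes the sums over the fibres exist; the coefficients do not involve
  \<open>d\<close>, so one power series serves all points.\<close>

lemma has_sum_monomial_regroup:
  fixes K :: "'a \<Rightarrow> real" and \<mu> :: "'a \<Rightarrow> nat monom"
  assumes "r > 0"
    and keys: "\<And>i. i \<in> I \<Longrightarrow> Poly_Mapping.keys (\<mu> i) \<subseteq> {..<n}"
    and summable: "(\<lambda>i. \<bar>K i\<bar> * r ^ monom_degree (\<mu> i)) summable_on I"
    and sum: "((\<lambda>i. K i * monom_eval (\<mu> i) d) has_sum s) I"
  shows "((\<lambda>\<alpha>. infsum K {i \<in> I. \<mu> i = \<alpha>} * monom_eval \<alpha> d) has_sum s)
    {\<alpha>. Poly_Mapping.keys \<alpha> \<subseteq> {..<n}}"
proof -
  let ?A = "{\<alpha>. Poly_Mapping.keys \<alpha> \<subseteq> {..<n}}" and ?B = "\<lambda>\<alpha>. {i \<in> I. \<mu> i = \<alpha>}"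
  have fibre: "K summable_on ?B \<alpha>" for \<alpha>
  proof -
    have "(\<lambda>i. \<bar>K i\<bar> * r ^ monom_degree (\<mu> i)) summable_on ?B \<alpha>"
      using summable by (rule summable_on_subset_banach) auto
    then have "(\<lambda>i. \<bar>K i\<bar> * r ^ monom_degree \<alpha>) summable_on ?B \<alpha>"
      by (rule summable_on_cong[THEN iffD1, rotated]) simp
    then show ?thesis
      using \<open>r > 0\<close> by (subst summable_on_iff_abs_summable_on_real) (simp add: summable_on_cmult_left')
  qed
  have bij: "bij_betw snd (Sigma ?A ?B) I"
    using keys by (auto simp: bij_betw_def inj_on_def image_iff)
  have "((\<lambda>p. K (snd p) * monom_eval (\<mu> (snd p)) d) has_sum s) (Sigma ?A ?B)"
    using has_sum_reindex_bij_betw[OF bij, of "\<lambda>i. K i * monom_eval (\<mu> i) d"] sum by simp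
  then show ?thesis
  proof (rule has_sum_SigmaD)
    fix \<alpha>
    have "((\<lambda>i. K i * monom_eval \<alpha> d) has_sum infsum K (?B \<alpha>) * monom_eval \<alpha> d) (?B \<alpha>)"
      by (intro has_sum_cmult_left has_sum_infsum fibre)
    then show "((\<lambda>i. K (snd (\<alpha>, i)) * monom_eval (\<mu> (snd (\<alpha>, i))) d) has_sum infsum K (?B \<alpha>) * monom_eval \<alpha> d) (?B \<alpha>)"
      by (rule has_sum_cong[THEN iffD1, rotated]) simp
  qed
qed

section \<open>Expansion of the kernel about a point\<close>

definition bimonom :: "nat \<Rightarrow> nat \<Rightarrow> nat monom" where
  "bimonom j k = Poly_Mapping.single 0 j + Poly_Mapping.single 1 k"

lemma lookup_bimonom: "Poly_Mapping.lookup (bimonom j k) i = (if i = 0 then j else if i = 1 then k else 0)"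
  by (simp add: bimonom_def lookup_add lookup_single when_def)

lemma keys_bimonom: "Poly_Mapping.keys (bimonom j k) \<subseteq> {..<2}"
  by (auto simp: in_keys_iff lookup_bimonom split: if_splits)

lemma monom_eval_bimonom: "monom_eval (bimonom j k) v = v 0 ^ j * v 1 ^ k"
  by (subst monom_eval_superset[OF _ keys_bimonom]) (simp_all add: numeral_2_eq_2 lookup_bimonom)

lemma monom_degree_bimonom: "monom_degree (bimonom j k) = j + k"
proof -
  have "monom_degree (bimonom j k) = (\<Sum>i<2. Poly_Mapping.lookup (bimonom j k) i)"
    unfolding monom_degree_def using keys_bimonom
    by (intro sum.mono_neutral_left) (auto simp: in_keys_iff)
  then show ?thesis
    by (simp add: numeral_2_eq_2 lookup_bimonom)
qed

text \<open>The summand at \<open>((l, (m, j)), k)\<close> comes from writing the kernel as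
  \<open>\<Sum>\<^sub>m \<xi>\<^sub>0 (- 1/2)\<^sup>m / 2 \<cdot> exp (- m \<xi>\<^sub>0 t) exp (- \<xi>\<^sub>1 t)\<close> and expanding the exponentials
  about \<open>(a\<^sub>0, a\<^sub>1)\<close>; the index \<open>l < 2\<close> splits the factor \<open>\<xi>\<^sub>0 = a\<^sub>0 + (\<xi>\<^sub>0 - a\<^sub>0)\<close>.\<close>

definition kterm :: "real \<Rightarrow> real \<Rightarrow> (nat \<times> nat \<times> nat) \<times> nat \<Rightarrow> real \<Rightarrow> real" where
  "kterm a0 a1 = (\<lambda>((l, m, j), k) t. (if l = 0 then a0 else 1) *
     ((- 1 / 2) ^ m / 2 * exp (- (real m * a0 * t)) * ((- (real m * t)) ^ j / fact j)) *
     ((- t) ^ k / fact k * exp (- (a1 * t))))"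

text \<open>Majorant, uniform in \<open>t\<close>, of a term times \<open>r\<close> to its degree;
  it uses \<open>t \<le> 1\<close>, \<open>exp (- (m * a0 * t)) \<le> 1\<close> and
  \<open>exp (- (a1 * t)) \<le> exp \<bar>a1\<bar>\<close>.\<close>

definition kbound :: "real \<Rightarrow> real \<Rightarrow> real \<Rightarrow> (nat \<times> nat \<times> nat) \<times> nat \<Rightarrow> real" where
  "kbound a0 a1 r = (\<lambda>((l, m, j), k). ((if l = 0 then a0 else 1) * r ^ l) *
     ((1 / 2) ^ m / 2 * ((real m * r) ^ j / fact j)) * (r ^ k / fact k * exp \<bar>a1\<bar>))"

definition kmonom :: "(nat \<times> nat \<times> nat) \<times> nat \<Rightarrow> nat monom" where
  "kmonom = (\<lambda>((l, m, j), k). bimonom (l + j) k)"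

definition kindex :: "((nat \<times> nat \<times> nat) \<times> nat) set" where
  "kindex = ({..<2} \<times> UNIV) \<times> UNIV"

lemma kterm_bound:
  assumes "a0 > 0" "r > 0" "t \<in> {0..1}"
  shows "\<bar>kterm a0 a1 i t\<bar> * r ^ monom_degree (kmonom i) \<le> kbound a0 a1 r i"
proof -
  obtain l m j k where i: "i = ((l, m, j), k)"
    by (metis prod.collapse)
  have "\<bar>kterm a0 a1 i t\<bar> * r ^ monom_degree (kmonom i) =
      ((if l = 0 then a0 else 1) * r ^ l) * ((1 / 2) ^ m / 2 * exp (- (real m * a0 * t)) * ((real m * r * t) ^ j / fact j)) *
      ((t * r) ^ k / fact k * exp (- (a1 * t)))"
    using assms by (simp add: i kterm_def kmonom_def monom_degree_bimonom abs_mult power_abs power_add power_mult_distrib)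
  also have "\<dots> \<le> ((if l = 0 then a0 else 1) * r ^ l) * ((1 / 2) ^ m / 2 * 1 * ((real m * r) ^ j / fact j)) *
      (r ^ k / fact k * exp \<bar>a1\<bar>)"
  proof -
    have "real m * r * t \<le> real m * r" "t * r \<le> r"
      using assms by (auto intro: mult_left_le mult_left_le_one_le)
    then have "(real m * r * t) ^ j / fact j \<le> (real m * r) ^ j / fact j" "(t * r) ^ k / fact k \<le> r ^ k / fact k"
      using assms by (auto intro!: divide_right_mono power_mono)
    moreover have "exp (- (real m * a0 * t)) \<le> 1"
      using assms by simp
    moreover have "exp (- (a1 * t)) \<le> exp \<bar>a1\<bar>"
    proof -
      have "- (a1 * t) \<le> \<bar>a1\<bar> * t"
        using assms abs_ge_minus_self[of "a1 * t"] by (simp add: abs_mult)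
      also have "\<dots> \<le> \<bar>a1\<bar>"
        using assms by (intro mult_left_le) auto
      finally show ?thesis by simp
    qed
    ultimately show ?thesis
      using assms by (intro mult_mono) auto
  qed
  finally show ?thesis
    by (simp add: i kbound_def)
qed

text \<open>Summing over \<open>j\<close> gives \<open>exp (m * r)\<close>, and the outer series is
  then geometric with ratio \<open>exp r / 2\<close>. This is where \<open>exp r < 2\<close> comes
  from.\<close>

lemma mixed_summable:
  fixes r :: real
  assumes "r > 0" "exp r < 2"
  shows "(\<lambda>(m, j). (1 / 2) ^ m / 2 * ((real m * r) ^ j / fact j)) summable_on UNIV \<times> UNIV"
proof (rule summable_on_SigmaI)
  show "((\<lambda>j. case (m, j) of (m, j) \<Rightarrow> (1 / 2) ^ m / 2 * ((real m * r) ^ j / fact j)) has_sum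
      (1 / 2) ^ m / 2 * exp (real m * r)) UNIV" for m
    by (simp only: prod.case) (intro has_sum_cmult_right has_sum_exp)
  have "((\<lambda>m. (exp r / 2) ^ m) has_sum 1 / (1 - exp r / 2)) UNIV"
    using assms by (intro has_sum_geometric) simp
  then have "(\<lambda>m. 1 / 2 * (exp r / 2) ^ m) summable_on UNIV"
    by (intro summable_on_cmult_right has_sum_imp_summable)
  moreover have "1 / 2 * (exp r / 2) ^ m = (1 / 2) ^ m / 2 * exp (real m * r)" for m
    by (simp only: exp_of_nat_mult power_divide power_one) simp
  ultimately show "(\<lambda>m. (1 / 2) ^ m / 2 * exp (real m * r)) summable_on UNIV"
    by (simp only:)
qed (use assms in auto)

lemma kbound_summable:
  assumes "a0 > 0" "r > 0" "exp r < 2"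
  shows "kbound a0 a1 r summable_on kindex"
proof -
  have 1: "((\<lambda>l. (if l = 0 then a0 else 1) * r ^ l) has_sum (\<Sum>l<2. (if l = 0 then a0 else 1) * r ^ l)) {..<2}"
    by (rule has_sum_finite) simp
  from mixed_summable[OF assms(2,3)]
  obtain s where 2: "((\<lambda>(m, j). (1 / 2) ^ m / 2 * ((real m * r) ^ j / fact j)) has_sum s) (UNIV \<times> UNIV)"
    unfolding summable_on_def by blast
  have 3: "((\<lambda>k. r ^ k / fact k * exp \<bar>a1\<bar>) has_sum exp r * exp \<bar>a1\<bar>) UNIV"
    by (intro has_sum_cmult_left has_sum_exp)
  from has_sum_Times[OF has_sum_Times[OF 1 2] 3] show ?thesis
    unfolding kindex_def kbound_def summable_on_def by (auto simp: case_prod_unfold)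
qed

text \<open>The kernel at the displaced point is a product of three series: the split of
  \<open>\<xi> 0\<close>, the double series of \<open>1 / (2 + exp (- (\<xi> 0 * t)))\<close>, and
  the exponential series for \<open>\<xi> 1\<close>.\<close>

lemma kterm_has_sum:
  assumes "a0 > 0" "r > 0" "exp r < 2" "\<bar>d 0\<bar> < r" "\<bar>d 1\<bar> < r" "a0 + d 0 > 0" "t \<in> {0..1}"
  shows "((\<lambda>i. kterm a0 a1 i t * monom_eval (kmonom i) d) has_sum laplace_kernel 0 (a0 + d 0) (a1 + d 1) t) kindex"
proof -
  let ?G = "\<lambda>(m, j). (- 1 / 2) ^ m / 2 * exp (- (real m * a0 * t)) * ((- (real m * t * d 0)) ^ j / fact j)"
  have 1: "((\<lambda>l. (if l = 0 then a0 else 1) * d 0 ^ l) has_sum (a0 + d 0)) {..<2}"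
    using has_sum_finite[of "{..<2}" "\<lambda>l. (if l = 0 then a0 else 1) * d 0 ^ l"]
    by (simp add: numeral_2_eq_2)
  have 2: "(?G has_sum 1 / (2 + exp (- ((a0 + d 0) * t)))) (UNIV \<times> UNIV)"
  proof (rule has_sum_SigmaI)
    show "((\<lambda>j. ?G (m, j)) has_sum (- 1 / 2) ^ m / 2 * exp (- (real m * a0 * t)) * exp (- (real m * t * d 0))) UNIV" for m
      by (simp only: prod.case) (intro has_sum_cmult_right has_sum_exp)
    \<comment> \<open>Ratio of the geometric series:
      \<open>1 / (2 + e) = 1 / 2 * (1 / (1 - z))\<close> with \<open>z = - e / 2\<close>. Positivity
      of \<open>a0 + d 0\<close> gives \<open>e \<le> 1\<close>.\<close>
    define z where "z = - exp (- ((a0 + d 0) * t)) / 2"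
    have "exp (- ((a0 + d 0) * t)) \<le> 1"
      using assms by simp
    moreover have "\<bar>z\<bar> = exp (- ((a0 + d 0) * t)) / 2"
      by (simp add: z_def)
    ultimately have "\<bar>z\<bar> < 1"
      by linarith
    then have "((\<lambda>m. 1 / 2 * z ^ m) has_sum 1 / 2 * (1 / (1 - z))) UNIV"
      by (intro has_sum_cmult_right has_sum_geometric)
    moreover have "1 / 2 * z ^ m = (- 1 / 2) ^ m / 2 * exp (- (real m * a0 * t)) * exp (- (real m * t * d 0))" for m
    proof -
      have "z ^ m = (- 1 / 2) ^ m * exp (- ((a0 + d 0) * t)) ^ m"
        by (simp add: z_def flip: power_mult_distrib)
      also have "exp (- ((a0 + d 0) * t)) ^ m = exp (- (real m * a0 * t)) * exp (- (real m * t * d 0))"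
        by (simp add: exp_of_nat_mult[symmetric] exp_add[symmetric] algebra_simps)
      finally show ?thesis by simp
    qed
    moreover have "1 / 2 * (1 / (1 - z)) = 1 / (2 + exp (- ((a0 + d 0) * t)))"
      by (simp add: z_def)
    ultimately show "((\<lambda>m. (- 1 / 2) ^ m / 2 * exp (- (real m * a0 * t)) * exp (- (real m * t * d 0))) has_sum
        1 / (2 + exp (- ((a0 + d 0) * t)))) UNIV"
      by (simp only:)
    \<comment> \<open>Row sums yield the double sum once the double family is known to be summable;
      the majorant at radius \<open>r\<close> provides this.\<close>
    have "(\<lambda>p. norm (?G p)) summable_on UNIV \<times> UNIV"
    proof (rule summable_on_comparison_test[OF mixed_summable[OF assms(2,3)]])
      fix p :: "nat \<times> nat"
      obtain m j where p: "p = (m, j)"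
        by fastforce
      have "\<bar>d 0\<bar> * t \<le> r * 1"
        using assms by (intro mult_mono) auto
      then have "real m * (\<bar>d 0\<bar> * t) \<le> real m * (r * 1)"
        by (intro mult_left_mono) auto
      then have "\<bar>real m * t * d 0\<bar> \<le> real m * r"
        using assms by (simp add: abs_mult mult_ac)
      then have "\<bar>- (real m * t * d 0)\<bar> ^ j \<le> (real m * r) ^ j"
        by (intro power_mono) auto
      then have "(1 / 2) ^ m / 2 * exp (- (real m * a0 * t)) * (\<bar>- (real m * t * d 0)\<bar> ^ j / fact j) \<le>
          (1 / 2) ^ m / 2 * 1 * ((real m * r) ^ j / fact j)"
        using assms by (intro mult_mono divide_right_mono) auto
      then show "norm (?G p) \<le> (case p of (m, j) \<Rightarrow> (1 / 2) ^ m / 2 * ((real m * r) ^ j / fact j))"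
        by (simp add: p abs_mult power_abs)
    qed auto
    then show "?G summable_on UNIV \<times> UNIV"
      by (rule abs_summable_summable)
  qed
  have 3: "((\<lambda>k. (- (t * d 1)) ^ k / fact k * exp (- (a1 * t))) has_sum exp (- (t * d 1)) * exp (- (a1 * t))) UNIV"
    by (intro has_sum_cmult_left has_sum_exp)
  define f where "f = (\<lambda>((l, m, j), k). ((if l = 0 then a0 else 1) * d 0 ^ l) * ?G (m, j) *
    ((- (t * d 1)) ^ k / fact k * exp (- (a1 * t))))"
  have "(f has_sum (a0 + d 0) * (1 / (2 + exp (- ((a0 + d 0) * t)))) * (exp (- (t * d 1)) * exp (- (a1 * t)))) kindex"
    using has_sum_Times[OF has_sum_Times[OF 1 2] 3]
    unfolding kindex_def f_def by (simp add: case_prod_unfold)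
  moreover have "(a0 + d 0) * (1 / (2 + exp (- ((a0 + d 0) * t)))) * (exp (- (t * d 1)) * exp (- (a1 * t))) =
      laplace_kernel 0 (a0 + d 0) (a1 + d 1) t"
    by (simp add: laplace_kernel_def exp_add[symmetric] algebra_simps)
  moreover have "f i = kterm a0 a1 i t * monom_eval (kmonom i) d" for i
  proof -
    obtain l m j k where i: "i = ((l, m, j), k)"
      by (metis prod.collapse)
    have "(- (real m * t * d 0)) ^ j = (- (real m * t)) ^ j * d 0 ^ j" "(- (t * d 1)) ^ k = (- t) ^ k * d 1 ^ k"
      by (simp_all flip: power_mult_distrib)
    then show ?thesis
      by (simp add: i f_def kterm_def kmonom_def monom_eval_bimonom power_add)
  qed
  ultimately show ?thesis
    by (simp only: has_sum_cong[of _ f])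
qed

text \<open>The kernel is expanded into the \<open>kterm\<close>, integrated term by term over
  \<open>t\<close>, and equal monomials are collected.\<close>

lemma real_analytic_phi: "real_analytic_on 2 phi half_plane"
  unfolding real_analytic_on_def
proof
  fix a assume a: "a \<in> half_plane"
  \<comment> \<open>This choice gives \<open>exp r = 3 / 2\<close>. It is independent of
    \<open>a\<close>: positivity of \<open>a 0 + d 0\<close> comes from
    \<open>x \<in> half_plane\<close>, not from a small radius.\<close>
  define r :: real where "r = ln (3 / 2)"
  have r: "r > 0" "exp r < 2"
    by (simp_all add: r_def)
  have a0: "a 0 > 0"
    using a by (simp add: half_plane_def)
  define K where "K i = integral {0..1} (kterm (a 0) (a 1) i)" for i
  have cont: "continuous_on {0..1} (kterm (a 0) (a 1) i)" for i
    unfolding kterm_def case_prod_unfold by (intro continuous_intros) auto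
  have K: "\<bar>K i\<bar> * r ^ monom_degree (kmonom i) \<le> kbound (a 0) (a 1) r i" for i
  proof -
    let ?n = "monom_degree (kmonom i)"
    have "norm (integral (cbox 0 1) (kterm (a 0) (a 1) i)) \<le> kbound (a 0) (a 1) r i / r ^ ?n * measure lborel (cbox 0 (1::real))"
    proof (rule integrable_bound)
      show "norm (kterm (a 0) (a 1) i t) \<le> kbound (a 0) (a 1) r i / r ^ ?n" if "t \<in> cbox 0 1" for t
        using kterm_bound[OF a0 r(1), of t "a 1" i] that r by (simp add: pos_le_divide_eq cbox_interval)
      then have "norm (kterm (a 0) (a 1) i 0) \<le> kbound (a 0) (a 1) r i / r ^ ?n"
        by (simp add: cbox_interval)
      then show "0 \<le> kbound (a 0) (a 1) r i / r ^ ?n"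
        by (rule order_trans[OF norm_ge_zero])
      show "kterm (a 0) (a 1) i integrable_on cbox 0 1"
        unfolding cbox_interval by (rule integrable_continuous_real[OF cont])
    qed
    then show ?thesis
      using r by (simp add: K_def cbox_interval pos_le_divide_eq)
  qed
  have K_summable: "(\<lambda>i. \<bar>K i\<bar> * r ^ monom_degree (kmonom i)) summable_on kindex"
    using kbound_summable[OF a0 r, of "a 1"] by (rule summable_on_comparison_test) (use K r in auto)
  show "\<exists>r>0. \<exists>c. \<forall>x\<in>half_plane. (\<forall>i<2. \<bar>x i - a i\<bar> < r) \<longrightarrow>
      ((\<lambda>\<alpha>. c \<alpha> * monom_eval \<alpha> (\<lambda>i. x i - a i)) has_sum phi x) {\<alpha>. Poly_Mapping.keys \<alpha> \<subseteq> {..<2}}"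
  proof (intro exI[of _ r] conjI exI[of _ "\<lambda>\<alpha>. infsum K {i \<in> kindex. kmonom i = \<alpha>}"] ballI impI)
    fix x assume x: "x \<in> half_plane" "\<forall>i<2. \<bar>x i - a i\<bar> < r"
    define d where "d i = x i - a i" for i
    have d: "\<bar>d 0\<bar> < r" "\<bar>d 1\<bar> < r" "a 0 + d 0 > 0"
      using x by (auto simp: d_def half_plane_def)
    have "((\<lambda>i. integral {0..1} (\<lambda>t. kterm (a 0) (a 1) i t * monom_eval (kmonom i) d)) has_sum
        integral {0..1} (laplace_kernel 0 (a 0 + d 0) (a 1 + d 1))) kindex"
    proof (rule has_sum_integral_interchange)
      show "continuous_on {0..1} (\<lambda>t. kterm (a 0) (a 1) i t * monom_eval (kmonom i) d)" for i
        by (intro continuous_intros cont)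
      show "\<bar>kterm (a 0) (a 1) i t * monom_eval (kmonom i) d\<bar> \<le> kbound (a 0) (a 1) r i"
        if "t \<in> {0..1}" for i t
      proof -
        obtain l m j k where i: "i = ((l, m, j), k)"
          by (metis prod.collapse)
        have "\<bar>monom_eval (kmonom i) d\<bar> \<le> r ^ (l + j) * r ^ k"
          using d r unfolding i kmonom_def
          by (auto simp: monom_eval_bimonom abs_mult power_abs intro!: mult_mono power_mono)
        also have "\<dots> = r ^ monom_degree (kmonom i)"
          by (simp add: i kmonom_def monom_degree_bimonom power_add)
        finally have "\<bar>kterm (a 0) (a 1) i t\<bar> * \<bar>monom_eval (kmonom i) d\<bar> \<le> \<bar>kterm (a 0) (a 1) i t\<bar> * r ^ monom_degree (kmonom i)"
          by (rule mult_left_mono) simp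
        then show ?thesis
          using kterm_bound[OF a0 r(1) that, of "a 1" i] by (simp add: abs_mult)
      qed
      show "((\<lambda>i. kterm (a 0) (a 1) i t * monom_eval (kmonom i) d) has_sum laplace_kernel 0 (a 0 + d 0) (a 1 + d 1) t) kindex"
        if "t \<in> {0..1}" for t
        using a0 r d that by (intro kterm_has_sum[of _ r])
    qed (rule kbound_summable[OF a0 r])
    then have "((\<lambda>i. K i * monom_eval (kmonom i) d) has_sum phi x) kindex"
      by (simp add: K_def phi_def laplace_deriv_def d_def)
    from has_sum_monomial_regroup[OF r(1) _ K_summable this, of 2]
    show "((\<lambda>\<alpha>. infsum K {i \<in> kindex. kmonom i = \<alpha>} * monom_eval \<alpha> (\<lambda>i. x i - a i)) has_sum phi x)
        {\<alpha>. Poly_Mapping.keys \<alpha> \<subseteq> {..<2}}"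
      by (simp add: d_def[abs_def] kmonom_def keys_bimonom case_prod_unfold)
  qed (use r in simp)
qed

subsection \<open>The quadratic system\<close>

lemma mpoly_eval_superset:
  assumes "finite T" "Poly_Mapping.keys p \<subseteq> T"
  shows "mpoly_eval p v = (\<Sum>\<alpha>\<in>T. Poly_Mapping.lookup p \<alpha> * monom_eval \<alpha> v)"
  unfolding mpoly_eval_def using assms
  by (intro sum.mono_neutral_left) (auto simp: in_keys_iff)

lemma mpoly_eval_add: "mpoly_eval (p + q) v = mpoly_eval p v + mpoly_eval q v"
proof -
  let ?T = "Poly_Mapping.keys p \<union> Poly_Mapping.keys q"
  have "Poly_Mapping.keys (p + q) \<subseteq> ?T"
    by (rule keys_add)
  then show ?thesis
    by (subst (1 2 3) mpoly_eval_superset[of ?T]) (auto simp: lookup_add distrib_right sum.distrib)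
qed

lemma mpoly_eval_single: "mpoly_eval (Poly_Mapping.single \<alpha> c) v = c * monom_eval \<alpha> v"
  by (subst mpoly_eval_superset[of "{\<alpha>}"]) auto

lemma monom_eval_single: "monom_eval (Poly_Mapping.single i n) v = v i ^ n"
  by (simp add: monom_eval_def)

lemma mpoly_degree_le_single: "monom_degree \<alpha> \<le> d \<Longrightarrow> mpoly_degree_le (Poly_Mapping.single \<alpha> c) d"
  by (simp add: mpoly_degree_le_def)

lemma mpoly_vars_single: "Poly_Mapping.keys \<alpha> \<subseteq> V \<Longrightarrow> mpoly_vars (Poly_Mapping.single \<alpha> c) \<subseteq> V"
  by (simp add: mpoly_vars_def)

lemma mpoly_degree_le_add: "mpoly_degree_le p d \<Longrightarrow> mpoly_degree_le q d \<Longrightarrow> mpoly_degree_le (p + q) d"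
  using keys_add[of p q] unfolding mpoly_degree_le_def by blast

lemma mpoly_vars_add: "mpoly_vars p \<subseteq> V \<Longrightarrow> mpoly_vars q \<subseteq> V \<Longrightarrow> mpoly_vars (p + q) \<subseteq> V"
  using keys_add[of p q] unfolding mpoly_vars_def by blast

section \<open>States and equations of the system\<close>

text \<open>The states are \<open>exp (- (\<xi> 1 * t))\<close>,
  \<open>1 / (2 + exp (- (\<xi> 0 * t)))\<close> and the running integral. Column 0 is multiplied by
  \<open>\<xi> 0\<close>, so the input supplies the factor \<open>\<xi> 0\<close> of the kernel and
  row 2 stays quadratic.\<close>

definition vector_field :: "(nat \<Rightarrow> real) \<Rightarrow> nat \<Rightarrow> nat \<Rightarrow> real" where
  "vector_field z j i =
    (if j = 0 \<and> i = 1 then - z 0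
     else if j = 1 \<and> i = 0 then z 1 - 2 * (z 1)\<^sup>2
     else if j = 2 \<and> i = 0 then z 0 * z 1
     else 0)"

definition trajectory :: "(nat \<Rightarrow> real) \<Rightarrow> real \<Rightarrow> nat \<Rightarrow> real" where
  "trajectory \<xi> t j =
    (if j = 0 then exp (- (\<xi> 1 * t))
     else if j = 1 then 1 / (2 + exp (- (\<xi> 0 * t)))
     else if j = 2 then integral {0..t} (laplace_kernel 0 (\<xi> 0) (\<xi> 1))
     else 0)"

text \<open>The three states at time 0, with \<open>1 / 3 = 1 / (2 + exp 0)\<close>; none depends on
  \<open>\<xi>\<close>.\<close>

definition initial_state :: "nat \<Rightarrow> real" where
  "initial_state j = (if j = 0 then 1 else if j = 1 then 1 / 3 else 0)"

lemma vector_field_quadratic: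
  "\<exists>p :: nat mpoly. mpoly_vars p \<subseteq> {..<3} \<and> mpoly_degree_le p 2 \<and> (\<forall>z. vector_field z j i = mpoly_eval p z)"
proof -
  let ?m = "\<lambda>i n. Poly_Mapping.single i n :: nat monom"
  have deg: "monom_degree (?m i n) = n" for i n
    by (simp add: monom_degree_def)
  consider "j = 0 \<and> i = 1" | "j = 1 \<and> i = 0" | "j = 2 \<and> i = 0"
    | "\<not> (j = 0 \<and> i = 1)" "\<not> (j = 1 \<and> i = 0)" "\<not> (j = 2 \<and> i = 0)"
    by blast
  then show ?thesis
  proof cases
    case 1
    then show ?thesis
      by (intro exI[of _ "Poly_Mapping.single (?m 0 1) (- 1)"] conjI mpoly_vars_single mpoly_degree_le_single)
        (auto simp: vector_field_def mpoly_eval_single monom_eval_single deg)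
  next
    case 2
    then show ?thesis
      by (intro exI[of _ "Poly_Mapping.single (?m 1 1) 1 + Poly_Mapping.single (?m 1 2) (- 2)"]
            conjI mpoly_vars_add mpoly_degree_le_add mpoly_vars_single mpoly_degree_le_single)
        (auto simp: vector_field_def mpoly_eval_add mpoly_eval_single monom_eval_single deg)
  next
    case 3
    have "monom_degree (bimonom 1 1) = 2" "Poly_Mapping.keys (bimonom 1 1) \<subseteq> {..<3}"
      using keys_bimonom[of 1 1] by (auto simp: monom_degree_bimonom)
    with 3 show ?thesis
      by (intro exI[of _ "Poly_Mapping.single (bimonom 1 1) 1"] conjI mpoly_vars_single mpoly_degree_le_single)
        (auto simp: vector_field_def mpoly_eval_single monom_eval_bimonom)
  next
    case 4
    then show ?thesis
      by (intro exI[of _ 0]) (auto simp: vector_field_def mpoly_vars_def mpoly_degree_le_def mpoly_eval_def)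
  qed
qed

lemma trajectory_solves:
  "state_trajectory 2 3 (topspace (Euclidean_space 3)) initial_state vector_field \<xi> (trajectory \<xi>)"
  unfolding state_trajectory_def
proof (intro conjI ballI allI impI)
  show "trajectory \<xi> 0 = initial_state"
    by (auto simp: trajectory_def initial_state_def)
  fix t :: real assume t: "t \<in> {0..1}"
  show "trajectory \<xi> t \<in> topspace (Euclidean_space 3)"
    by (auto simp: topspace_Euclidean_space trajectory_def)
  fix j :: nat assume "j < 3"
  then consider "j = 0" | "j = 1" | "j = 2"
    by linarith
  then show "((\<lambda>t. trajectory \<xi> t j) has_real_derivative (\<Sum>i<2. vector_field (trajectory \<xi> t) j i * \<xi> i)) (at t within {0..1})"
  proof cases
    case 1
    have "((\<lambda>t. exp (- (\<xi> 1 * t))) has_real_derivative - exp (- (\<xi> 1 * t)) * \<xi> 1) (at t within {0..1})"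
      by (auto intro!: derivative_eq_intros)
    then show ?thesis
      by (simp add: 1 trajectory_def vector_field_def numeral_2_eq_2)
  next
    case 2
    define e where "e = exp (- (\<xi> 0 * t))"
    have e: "2 + e \<noteq> 0"
      unfolding e_def by (rule two_plus_exp_pos)
    have "((\<lambda>t. 1 / (2 + exp (- (\<xi> 0 * t)))) has_real_derivative e * \<xi> 0 / (2 + e)\<^sup>2) (at t within {0..1})"
      unfolding e_def by (auto intro!: derivative_eq_intros simp: two_plus_exp_pos power2_eq_square)
    \<comment> \<open>Rewriting one factor \<open>e / (2 + e)\<close> as
      \<open>1 - 2 / (2 + e)\<close> removes the exponential and leaves a quadratic polynomial in
      the state.\<close>
    moreover have "e * \<xi> 0 / (2 + e)\<^sup>2 = (1 / (2 + e) - 2 * (1 / (2 + e))\<^sup>2) * \<xi> 0"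
    proof -
      have "e * (1 / (2 + e)) = 1 - 2 * (1 / (2 + e))"
        using e by (simp add: field_simps)
      moreover have "e * \<xi> 0 / (2 + e)\<^sup>2 = e * (1 / (2 + e)) * (1 / (2 + e)) * \<xi> 0"
        by (simp add: power2_eq_square)
      ultimately show ?thesis
        by (simp only: power2_eq_square) (simp only: algebra_simps)
    qed
    ultimately show ?thesis
      by (simp add: 2 trajectory_def vector_field_def numeral_2_eq_2 e_def)
  next
    case 3
    have "((\<lambda>t. integral {0..t} (laplace_kernel 0 (\<xi> 0) (\<xi> 1))) has_real_derivative laplace_kernel 0 (\<xi> 0) (\<xi> 1) t)
        (at t within {0..1})"
      using t by (intro integral_has_real_derivative continuous_on_laplace_kernel)
    then show ?thesis
      by (simp add: 3 trajectory_def vector_field_def numeral_2_eq_2 laplace_kernel_def)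
  qed
qed

text \<open>The explicit trajectories solve the system for every input, so the state space is all of
  \<open>Euclidean_space 3\<close> and \<open>X\<close> is arbitrary; the output is the third
  state.\<close>

lemma has_Q_FISCIDS_rep_phi: "has_Q_FISCIDS_rep 2 1 X (\<lambda>\<xi> _. phi \<xi>)"
proof -
  have out: "trajectory \<xi> 1 2 = phi \<xi>" for \<xi>
    by (simp add: trajectory_def phi_def laplace_deriv_def)
  have "Q_FISCIDS_rep 2 1 X (\<lambda>\<xi> _. phi \<xi>) 3 (topspace (Euclidean_space 3)) initial_state vector_field (\<lambda>z _. z 2)"
    unfolding Q_FISCIDS_rep_def FISCIDS_rep_def
  proof (intro conjI)
    show "initial_state \<in> topspace (Euclidean_space 3)"
      by (auto simp: topspace_Euclidean_space initial_state_def)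
    show "\<forall>\<xi>\<in>X. \<exists>z. state_trajectory 2 3 (topspace (Euclidean_space 3)) initial_state vector_field \<xi> z \<and> (\<forall>k<1. z 1 2 = phi \<xi>)"
      using trajectory_solves out by blast
    show "\<forall>j<3. \<forall>i<2. \<exists>p :: nat mpoly. mpoly_vars p \<subseteq> {..<3} \<and> mpoly_degree_le p 2 \<and>
        (\<forall>z\<in>topspace (Euclidean_space 3). vector_field z j i = mpoly_eval p z)"
      using vector_field_quadratic by blast
    show "\<forall>k<1. \<exists>b c. \<forall>z\<in>topspace (Euclidean_space 3). z 2 = b + (\<Sum>j<3. c j * z j)"
      by (intro allI impI exI[of _ 0] exI[of _ "\<lambda>j. if j = 2 then 1 else 0"]) (simp add: numeral_3_eq_3 numeral_2_eq_2)
  qed auto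
  then show ?thesis
    unfolding has_Q_FISCIDS_rep_def by blast
qed

theorem theorem5:
  shows "\<exists>(n::nat) (X :: (nat \<Rightarrow> real) set) (\<phi> :: (nat \<Rightarrow> real) \<Rightarrow> real).
           openin (Euclidean_space n) X \<and> TT_on n \<phi> X \<and>
           has_Q_FISCIDS_rep n 1 X (\<lambda>\<xi> _. \<phi> \<xi>)"
  using openin_half_plane real_analytic_phi not_DA_phi has_Q_FISCIDS_rep_phi
  unfolding TT_on_def by blast

end
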